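(* Let $\mathbf{S}_0$ be the $2$-adic Banach space of $2^{-1/2}$-overconvergent cuspidal $2$-adic modular forms of weight $0$ and tame level $1$ over $\mathbf{Q}_2$, and let $\mathbf{C}_2$ be the completion of an algebraic closure of $\mathbf{Q}_2$. Let $F=q+\cdots\in\mathbf{S}_0\widehat{\otimes}\mathbf{C}_2$ be a normalised finite slope overconvergent eigenform. Then the ($q$-expansion) coefficients of $F$ are all in $\mathbf{Q}_2$.
   Context: Let $\Delta(\tau)=q\prod_{n\ge1}(1-q^n)^{24}$, $q=e^{2\pi i\tau}$, $f(\tau)=\Delta(2\tau)/\Delta(\tau)=q+24q^2+\cdots$ and $g=2^6f$. The space $\mathbf{M}_0$ of $2^{-1/2}$-overconvergent $2$-adic modular forms of weight $0$ and tame level $1$ is the Banach space (with supremum norm) of rigid analytic functions over $\mathbf{Q}_2$ on the affinoid $X_0(1)_{\ge 2^{-1/2}}$ of the level one modular curve obtained by removing the open disc of radius $2^{-1/2}$ (in the sense of a suitable local parameter after adding auxiliary level structure) over the supersingular point. Concretely this affinoid is the region $\{|j|\ge 2^{-6}\}$ of the $j$-line, and it is identified (preserving $q$-expansions) with the region $\{|g|\le 1\}$ of $X_0(2)$; thus $\mathbf{M}_0$ is the space of series $\sum_{n\ge0}a_ng^n$ with $a_n\in\mathbf{Q}_2$, $a_n\to0$, with norm $\max_n|a_n|$. The subspace $\mathbf{S}_0=\mathbf{S}_0(\mathrm{SL}_2(\mathbf{Z});\mathbf{Q}_2;2^{-1/2})$ consists of the elements whose $q$-expansion has zero constant term, i.e.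 the series $\sum_{n\ge1}a_ng^n$ with $a_n\to 0$; $\mathbf{S}_0\widehat{\otimes}\mathbf{C}_2$ is the completed tensor product over $\mathbf{Q}_2$ (the same series with $a_n\in\mathbf{C}_2$, $a_n\to0$). The Hecke operators act continuously on these spaces; on $q$-expansions $U=U_2$ acts by $U(\sum a_nq^n)=\sum a_{2n}q^n$, and for an odd prime $\ell$, $T_\ell(\sum a_nq^n)=\sum (a_{\ell n}+\ell^{-1}a_{n/\ell})q^n$ (with $a_{n/\ell}=0$ if $\ell\nmid n$). An eigenform is a simultaneous eigenvector of $U$ and all $T_\ell$; it is normalised if its coefficient of $q$ is $1$, and of finite slope if its $U$-eigenvalue is non-zero. *)

theory Defs
  imports "HOL-Analysis.Analysis"
begin

section \<open>The fields \<open>Q\<^sub>2\<close> and \<open>C\<^sub>2\<close>\<close>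

text \<open>
  The library's \<open>norm\<close> is constrained to real normed vector spaces, so a non-archimedean
  absolute value needs its own constant; limits and closures are those of the induced metric.
\<close>

class nonarch_valued_field = field_char_0 + metric_space +
  fixes absval :: "'a \<Rightarrow> real"
  assumes absval_eq_0_iff: "absval x = 0 \<longleftrightarrow> x = 0"
    and absval_mult: "absval (x * y) = absval x * absval y"
    and absval_add_le_max: "absval (x + y) \<le> max (absval x) (absval y)"
    and dist_absval: "dist x y = absval (x - y)"

text \<open>
  In a complete extension of the 2-adically valued rationals, \<open>Q2\<close> is the completion of the
  rationals and \<open>Q2bar\<close> is the set of elements algebraic over it.
\<close>

definition Q2 :: "'a::nonarch_valued_field set"
  where "Q2 = closure \<rat>"

definition Q2bar :: "'a::nonarch_valued_field set"
  where "Q2bar = {x. \<exists>p. p \<noteq> 0 \<and> (\<forall>i. coeff p i \<in> Q2) \<and> poly p x = 0}"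

text \<open>
  The type is a model of \<open>C\<^sub>2\<close>: a complete field whose absolute value extends the 2-adic one on
  the rationals (by multiplicativity, it is enough to say so on the integers), and in which an
  algebraic closure of \<open>Q\<^sub>2\<close> is dense. This determines it up to isometric isomorphism.
\<close>

definition is_C2 :: "'a::nonarch_valued_field itself \<Rightarrow> bool"
  where "is_C2 _ \<longleftrightarrow>
    (\<forall>n. n \<noteq> 0 \<longrightarrow> absval (of_int n :: 'a) = (1 / 2) ^ multiplicity 2 n) \<and>
    complete (UNIV :: 'a set) \<and>
    (\<forall>p :: 'a poly. (\<forall>i. coeff p i \<in> Q2bar) \<and> degree p > 0 \<longrightarrow> (\<exists>x \<in> Q2bar. poly p x = 0)) \<and>
    closure (Q2bar :: 'a set) = UNIV"


section \<open>Overconvergent forms of weight 0\<close>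

text \<open>Forms are represented by their \<open>q\<close>-expansions, with \<open>fps_X\<close> in the role of \<open>q\<close>.\<close>

definition Delta :: "'a::field_char_0 fps"
  where "Delta = fps_X * (\<Prod>n. (1 - fps_X ^ (n + 1)) ^ 24)"

text \<open>\<open>\<Delta>(2\<tau>)\<close> is obtained from \<open>\<Delta>(\<tau>)\<close> by substituting \<open>q\<^sup>2\<close> for \<open>q\<close>.\<close>

definition form_f :: "'a::field_char_0 fps"
  where "form_f = fps_compose Delta (fps_X ^ 2) / Delta"

definition form_g :: "'a::field_char_0 fps"
  where "form_g = fps_const (2 ^ 6) * form_f"

text \<open>
  \<open>M0 K\<close> is the set of \<open>q\<close>-expansions of the series \<open>\<Sum>n. a n * g ^ n\<close> with coefficients in \<open>K\<close>
  tending to 0. As \<open>g\<close> has zero constant term, each coefficient of the expansion is a finite sum,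
  which is what \<open>fps_compose\<close> computes; as its linear term is non-zero, the expansion
  determines the \<open>a n\<close>. The space over the 2-adic numbers is \<open>M0 Q2\<close>, and its completed tensor
  product with \<open>C\<^sub>2\<close> is \<open>M0 UNIV\<close>. Similarly for the cuspidal subspace \<open>S0\<close>.
\<close>

definition M0 :: "'a::nonarch_valued_field set \<Rightarrow> 'a fps set"
  where "M0 K = {fps_compose (Abs_fps a) form_g | a. range a \<subseteq> K \<and> a \<longlonglongrightarrow> 0}"

definition S0 :: "'a::nonarch_valued_field set \<Rightarrow> 'a fps set"
  where "S0 K = {F \<in> M0 K. fps_nth F 0 = 0}"

definition hecke_U :: "'a::field_char_0 fps \<Rightarrow> 'a fps"
  where "hecke_U F = Abs_fps (\<lambda>n. fps_nth F (2 * n))"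

definition hecke_T :: "nat \<Rightarrow> 'a::field_char_0 fps \<Rightarrow> 'a fps"
  where "hecke_T l F = Abs_fps (\<lambda>n. fps_nth F (l * n) +
    (if l dvd n then inverse (of_nat l) * fps_nth F (n div l) else 0))"

definition eigenform :: "'a::field_char_0 fps \<Rightarrow> bool"
  where "eigenform F \<longleftrightarrow> F \<noteq> 0 \<and>
    (\<exists>c. hecke_U F = fps_const c * F) \<and>
    (\<forall>l. prime l \<and> odd l \<longrightarrow> (\<exists>c. hecke_T l F = fps_const c * F))"

definition normalised :: "'a::field_char_0 fps \<Rightarrow> bool"
  where "normalised F \<longleftrightarrow> fps_nth F 1 = 1"

definition finite_slope :: "'a::field_char_0 fps \<Rightarrow> bool"
  where "finite_slope F \<longleftrightarrow> (\<exists>c. c \<noteq> 0 \<and> hecke_U F = fps_const c * F)"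


section \<open>First coefficients of \<open>f\<close>\<close>

lemma Delta_factor_nth:
  fixes n :: nat
  defines "h \<equiv> (1 - fps_X ^ (n + 1)) ^ 24 :: 'a::field_char_0 fps"
  shows "fps_nth h 0 = 1" "fps_nth h 1 = (if n = 0 then -24 else 0)"
proof -
  have *: "fps_nth (1 - fps_X ^ (n + 1) :: 'a fps) 0 = 1" by simp
  show "fps_nth h 0 = 1"
    unfolding h_def by (rule fps_power_zeroth_eq_one) (rule *)
  show "fps_nth h 1 = (if n = 0 then -24 else 0)"
    unfolding h_def by (subst fps_power_first_eq[OF *]) (auto simp: fps_X_power_iff)
qed

lemma Delta_prod_nth:
  fixes n :: nat
  defines "P \<equiv> (\<Prod>k\<le>n. (1 - fps_X ^ (k + 1)) ^ 24) :: 'a::field_char_0 fps"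
  shows "fps_nth P 0 = 1" "fps_nth P 1 = -24"
proof -
  have "fps_nth P 0 = 1 \<and> fps_nth P 1 = -24"
    unfolding P_def
  proof (induction n)
    case 0
    show ?case using Delta_factor_nth[where ?'a='a, of 0] by simp
  next
    case (Suc n)
    then show ?case
      using Delta_factor_nth[where ?'a='a, of "Suc n"]
      by (simp only: prod.atMost_Suc fps_mult_nth_0 fps_mult_nth_1) simp
  qed
  then show "fps_nth P 0 = 1" "fps_nth P 1 = -24" by auto
qed

lemma Delta_has_prod:
  "(\<lambda>n. (1 - fps_X ^ (n + 1)) ^ 24 :: 'a::field_char_0 fps) has_prod
     (\<Prod>n. (1 - fps_X ^ (n + 1)) ^ 24)"
proof -
  define h :: "nat \<Rightarrow> 'a fps" where "h = (\<lambda>n. (1 - fps_X ^ (n + 1)) ^ 24)"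
  define Q where "Q = (\<lambda>n. \<Prod>k\<le>n. h k)"
  define P where "P = Abs_fps (\<lambda>n. fps_nth (Q n) n)"
  have stable: "fps_nth (Q N) n = fps_nth (Q n) n" if "N \<ge> n" for n N
    using that
  proof (induction N rule: dec_induct)
    case (step N)
    have "fps_X ^ (Suc N + 1) dvd 1 - h (Suc N)"
    proof -
      have "(1 - fps_X ^ (Suc N + 1)) - 1 dvd h (Suc N) - (1 :: 'a fps) ^ 24"
        unfolding h_def power_diff_sumr2[of _ 24 1] by simp
      then show ?thesis
        by (metis dvd_minus_iff minus_diff_eq diff_diff_eq2 add_diff_cancel_left' minus_dvd_iff power_one)
    qed
    then obtain r where "h (Suc N) = 1 - fps_X ^ (Suc N + 1) * r"
      by (metis dvdE diff_eq_eq add.commute)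
    then have "Q (Suc N) = Q N - fps_X ^ (Suc N + 1) * (Q N * r)"
      unfolding Q_def prod.atMost_Suc by (simp only: right_diff_distrib mult_1_left mult_1_right ac_simps)
    then have "fps_nth (Q (Suc N)) n = fps_nth (Q N) n"
      using step.hyps by (simp only: fps_sub_nth fps_X_power_mult_nth) simp
    then show ?case using step.IH by simp
  qed simp
  have lim: "Q \<longlonglongrightarrow> P"
  proof (rule tendsto_fpsI)
    fix n
    show "\<forall>\<^sub>F N in sequentially. fps_nth (Q N) n = fps_nth P n"
      using eventually_ge_at_top[of n]
    proof eventually_elim
      case (elim N)
      show ?case unfolding P_def fps_nth_Abs_fps by (rule stable) (rule elim)
    qed
  qed
  have "fps_nth P 0 = 1"
    using Delta_prod_nth(1)[where ?'a='a, of 0] by (simp add: P_def Q_def h_def)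
  then have "P \<noteq> 0" by auto
  then have "h has_prod P"
    using lim by (simp add: has_prod_def raw_has_prod_def Q_def)
  moreover from this have "P = prodinf h"
    by (rule has_prod_unique)
  ultimately have "h has_prod prodinf h"
    by (simp only:)
  then show ?thesis
    unfolding h_def .
qed

lemma form_f_nth:
  "fps_nth (form_f :: 'a::field_char_0 fps) 0 = 0"
  "fps_nth (form_f :: 'a fps) 1 = 1"
  "fps_nth (form_f :: 'a fps) 2 = 24"
proof -
  define P :: "'a fps" where "P = (\<Prod>n. (1 - fps_X ^ (n + 1)) ^ 24)"
  have Pn: "fps_nth P 0 = 1 \<and> fps_nth P 1 = -24"
  proof -
    have "(1 - fps_X ^ (n + 1)) ^ 24 \<noteq> (0 :: 'a fps)" for n
      using Delta_factor_nth(1)[where ?'a='a, of n] by (metis fps_zero_nth zero_neq_one)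
    then have "raw_has_prod (\<lambda>n. (1 - fps_X ^ (n + 1)) ^ 24) 0 P"
      using Delta_has_prod[where ?'a='a] unfolding has_prod_def P_def[symmetric] by fast
    then have lim: "(\<lambda>n. \<Prod>k\<le>n. (1 - fps_X ^ (k + 1)) ^ 24) \<longlonglongrightarrow> P"
      unfolding raw_has_prod_def by simp
    have "\<forall>\<^sub>F n in sequentially. fps_nth P 0 = 1" "\<forall>\<^sub>F n in sequentially. fps_nth P 1 = -24"
      using lim[unfolded tendsto_fps_iff, rule_format, of 0]
            lim[unfolded tendsto_fps_iff, rule_format, of 1]
      unfolding Delta_prod_nth by (auto elim: eventually_mono)
    then show ?thesis by simp
  qed
  define R where "R = P oo fps_X ^ 2"
  have Rn: "fps_nth R 0 = 1" "fps_nth R 1 = 0"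
    using Pn unfolding R_def by (simp_all add: fps_compose_nth fps_X_power_iff)
  have "Delta oo fps_X ^ 2 = fps_X ^ 2 * R"
    unfolding Delta_def P_def[symmetric] R_def by (simp add: fps_compose_mult_distrib)
  then have "form_f = (fps_X * (fps_X * R)) / (fps_X * P)"
    unfolding form_f_def by (simp add: Delta_def P_def power2_eq_square mult.assoc)
  also have "\<dots> = (fps_X * R) / P"
    by simp
  also have "\<dots> = fps_X * (R * inverse P)"
    using Pn by (simp add: fps_divide_unit mult.assoc)
  finally have f: "form_f = fps_X * (R * inverse P)" .
  have "fps_nth (P * inverse P) 1 = 0"
    using Pn by (subst inverse_mult_eq_1') auto
  then have "fps_nth (inverse P) 1 = 24"
    using Pn by simp
  then have "fps_nth (R * inverse P) 0 = 1" "fps_nth (R * inverse P) 1 = 24"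
    using Rn Pn by (simp_all add: fps_mult_nth_1)
  then show "fps_nth (form_f :: 'a::field_char_0 fps) 0 = 0"
    "fps_nth (form_f :: 'a fps) 1 = 1" "fps_nth (form_f :: 'a fps) 2 = 24"
    unfolding f by simp_all
qed

end

theory Submission
  imports Defs "HOL-Computational_Algebra.Formal_Laurent_Series"
begin

text \<open>
  The function \<open>g\<close> satisfies the quadratic modular equation
  \<open>g(q) + g(-q) = 48 g(q\<^sup>2) + 64 g(q\<^sup>2)\<^sup>2\<close>, \<open>g(q) g(-q) = -64 g(q\<^sup>2)\<close>, which is Jacobi's identity
  \<open>\<theta>\<^sub>3\<^sup>4 = \<theta>\<^sub>4\<^sup>4 + \<theta>\<^sub>2\<^sup>4\<close> in disguise. Newton's recurrence for power sums then gives the matrix of \<open>U\<close> in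
  the basis of powers of \<open>g\<close> in closed form. Following Buzzard and Calegari, this matrix factors as
  \<open>A D B\<close> with \<open>A\<close> lower and \<open>B\<close> upper triangular, both rational and congruent to the identity modulo 2, and \<open>D\<close>
  diagonal with absolute values of its entries decreasing by a factor of at least 4 at each step.

  Rationality of an eigenvector needs neither Newton polygons nor Galois theory: after scaling, the
  coordinates of \<open>D B a\<close> satisfy a system which, if all of them lie within distance \<open>s \<le> 1\<close> of the rational
  numbers, forces them to lie within distance \<open>s / 2\<close>. Hence they lie in the closure of the rationals.
\<close>

section \<open>Euler products and theta series\<close>

text \<open>The obstacle is the eigenvalue c, which is only known to lie in the large field: the
  coordinates of an eigenvector satisfy linear equations over the rationals only once c is rational.
  Solving row m for c, where |z_m| is largest and z_m is scaled to 1, and substituting makes the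
  other rows quadratic but free of c. Row k is then solved for z_k after division by the larger of
  d_k and d_m in absolute value. Every remaining term carries a rational factor of absolute value at
  most 1/2, either a ratio of diagonal entries or an entry of B A - 1, and the ultrametric
  inequality turns this into the gain of a factor 2. Passing from a to D B a moves D to the outside,
  so that each row has a single factor d_k to divide by. This determines the eigenvector only up to
  a scalar; the scalar is controlled at the end by the coefficient of q, which is 1.\<close>

lemma tendsto_fps_eventually_le:
  fixes A :: "'a::group_add fps"
  assumes "(a \<longlongrightarrow> A) F"
  shows "eventually (\<lambda>x. \<forall>k\<le>n. fps_nth (a x) k = fps_nth A k) F"
  by (rule eventually_compose_filterlim[OF eventually_fps_nth_eq_nhds_fps_strong assms])

text \<open>Convergence of formal power series means that each coefficient is eventually constant.
  Coefficient n of a product involves only the coefficients up to n of the factors, and these settle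
  simultaneously.\<close>

lemma tendsto_mult_fps:
  fixes A B :: "'a::comm_ring_1 fps"
  assumes "(a \<longlongrightarrow> A) F" "(b \<longlongrightarrow> B) F"
  shows "((\<lambda>x. a x * b x) \<longlongrightarrow> A * B) F"
proof (rule tendsto_fpsI)
  fix n
  show "eventually (\<lambda>x. fps_nth (a x * b x) n = fps_nth (A * B) n) F"
    using tendsto_fps_eventually_le[OF assms(1), of n] tendsto_fps_eventually_le[OF assms(2), of n]
    by eventually_elim (simp add: fps_mult_nth)
qed

lemma tendsto_compose_fps:
  fixes A C :: "'a::comm_ring_1 fps"
  assumes "(a \<longlongrightarrow> A) F"
  shows "((\<lambda>x. a x oo C) \<longlongrightarrow> A oo C) F"
proof (rule tendsto_fpsI)
  fix n
  show "eventually (\<lambda>x. fps_nth (a x oo C) n = fps_nth (A oo C) n) F"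
    using tendsto_fps_eventually_le[OF assms, of n]
    by eventually_elim (simp add: fps_compose_nth)
qed

lemma tendsto_power_fps:
  fixes A :: "'a::comm_ring_1 fps"
  assumes "(a \<longlongrightarrow> A) F"
  shows "((\<lambda>x. a x ^ m) \<longlongrightarrow> A ^ m) F"
  by (induction m) (auto intro: tendsto_mult_fps assms)

lemma fps_prod_nth_stable:
  fixes r :: "nat \<Rightarrow> 'a::comm_ring_1 fps"
  assumes "n \<le> N"
  shows "fps_nth (\<Prod>k<N. 1 + fps_X ^ Suc k * r k) n = fps_nth (\<Prod>k<n. 1 + fps_X ^ Suc k * r k) n"
  using assms
proof (induction N rule: dec_induct)
  case (step N)
  define Q where "Q = (\<Prod>k<N. 1 + fps_X ^ Suc k * r k)"
  have "(\<Prod>k<Suc N. 1 + fps_X ^ Suc k * r k) = Q + fps_X ^ Suc N * (r N * Q)"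
    by (simp only: prod.lessThan_Suc Q_def[symmetric]) (simp add: algebra_simps)
  then show ?case
    using step by (simp only: fps_add_nth fps_X_power_mult_nth) (simp add: Q_def)
qed simp

lemma fps_prod_tendsto:
  fixes r :: "nat \<Rightarrow> 'a::comm_ring_1 fps"
  shows "(\<lambda>N. \<Prod>k<N. 1 + fps_X ^ Suc k * r k) \<longlonglongrightarrow>
    Abs_fps (\<lambda>n. fps_nth (\<Prod>k<n. 1 + fps_X ^ Suc k * r k) n)"
proof (rule tendsto_fpsI)
  fix n
  show "\<forall>\<^sub>F N in sequentially. fps_nth (\<Prod>k<N. 1 + fps_X ^ Suc k * r k) n =
      fps_nth (Abs_fps (\<lambda>n. fps_nth (\<Prod>k<n. 1 + fps_X ^ Suc k * r k) n)) n"
    unfolding fps_nth_Abs_fps using eventually_ge_at_top[of n]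
    by eventually_elim (rule fps_prod_nth_stable)
qed

text \<open>The infinite product is encoded by its diagonal: factors from index n on are 1 modulo
  q^(n+1), so the n-th partial product already has the final coefficient n.\<close>

definition euler_plus :: "'a::field_char_0 fps"
  where "euler_plus = Abs_fps (\<lambda>n. fps_nth (\<Prod>k<n. 1 + fps_X ^ Suc k) n)"

definition euler_minus :: "'a::field_char_0 fps"
  where "euler_minus = Abs_fps (\<lambda>n. fps_nth (\<Prod>k<n. 1 - fps_X ^ Suc k) n)"

lemma euler_plus_tendsto:
  "(\<lambda>N. \<Prod>k<N. 1 + fps_X ^ Suc k :: 'a::field_char_0 fps) \<longlonglongrightarrow> euler_plus"
  using fps_prod_tendsto[of "\<lambda>_. 1 :: 'a fps"] by (simp only: mult_1_right euler_plus_def)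

lemma euler_minus_tendsto:
  "(\<lambda>N. \<Prod>k<N. 1 - fps_X ^ Suc k :: 'a::field_char_0 fps) \<longlonglongrightarrow> euler_minus"
  using fps_prod_tendsto[of "\<lambda>_. - 1 :: 'a fps"]
  by (simp only: mult_minus_right mult_1_right add_uminus_conv_diff euler_minus_def)

lemma euler_nth_0: "fps_nth euler_plus 0 = 1" "fps_nth euler_minus 0 = 1"
  by (simp_all add: euler_plus_def euler_minus_def)

lemma prod_X_power_compose:
  fixes C :: "'a::idom fps"
  assumes "fps_nth C 0 = 0"
  shows "(\<Prod>k<N. 1 + fps_X ^ Suc k) oo C = (\<Prod>k<N. 1 + C ^ Suc k)"
    and "(\<Prod>k<N. 1 - fps_X ^ Suc k) oo C = (\<Prod>k<N. 1 - C ^ Suc k)"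
  using assms
  by (simp_all only: fps_compose_prod_distrib fps_compose_add_distrib fps_compose_sub_distrib
    fps_X_power_compose fps_compose_1)

lemma euler_minus_mult_plus:
  "euler_minus * euler_plus = (euler_minus oo fps_X ^ 2 :: 'a::field_char_0 fps)"
proof (rule LIMSEQ_unique)
  show "(\<lambda>N. (\<Prod>k<N. 1 - fps_X ^ Suc k) * (\<Prod>k<N. 1 + fps_X ^ Suc k :: 'a fps))
      \<longlonglongrightarrow> euler_minus * euler_plus"
    by (intro tendsto_mult_fps euler_minus_tendsto euler_plus_tendsto)
  have "(\<Prod>k<N. 1 - fps_X ^ Suc k) * (\<Prod>k<N. 1 + fps_X ^ Suc k :: 'a fps)
      = (\<Prod>k<N. 1 - fps_X ^ Suc k) oo fps_X ^ 2" for N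
  proof -
    have "(1 - x ^ Suc k) * (1 + x ^ Suc k) = 1 - (x\<^sup>2) ^ Suc k" for x :: "'a fps" and k
    proof -
      have "(x\<^sup>2) ^ Suc k = x ^ Suc k * x ^ Suc k"
        by (simp only: power2_eq_square power_mult_distrib)
      then show ?thesis
        using square_diff_square_factored[of 1 "x ^ Suc k"] by (simp only: mult_1_left mult.commute)
    qed
    moreover have "fps_nth (fps_X\<^sup>2 :: 'a fps) 0 = 0" by simp
    ultimately show ?thesis
      by (simp only: prod_X_power_compose prod.distrib[symmetric])
  qed
  then show "(\<lambda>N. (\<Prod>k<N. 1 - fps_X ^ Suc k) * (\<Prod>k<N. 1 + fps_X ^ Suc k :: 'a fps))
      \<longlonglongrightarrow> (euler_minus oo fps_X ^ 2)"
    using tendsto_compose_fps[OF euler_minus_tendsto] by (simp only:)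
qed

text \<open>In both products the factors with even exponent cancel.\<close>

lemma euler_minus_uminus:
  "(euler_minus oo - fps_X) * (euler_plus oo fps_X ^ 2) =
    (euler_minus oo fps_X ^ 2) * (euler_plus :: 'a::field_char_0 fps)"
proof (rule LIMSEQ_unique)
  \<comment> \<open>Truncating at 2N in the variables q and -q and at N in q^2 makes the identity
    exact for the partial products themselves.\<close>
  have *: "filterlim (\<lambda>N::nat. 2 * N) sequentially sequentially"
    by (rule filterlim_subseq) (simp add: strict_mono_def)
  show "(\<lambda>N. ((\<Prod>k<2*N. 1 - fps_X ^ Suc k) oo - fps_X) * ((\<Prod>k<N. 1 + fps_X ^ Suc k) oo fps_X ^ 2 :: 'a fps))
      \<longlonglongrightarrow> (euler_minus oo - fps_X) * (euler_plus oo fps_X ^ 2)"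
    by (intro tendsto_mult_fps tendsto_compose_fps euler_plus_tendsto
      filterlim_compose[OF euler_minus_tendsto *])
  have "((\<Prod>k<2*N. 1 - fps_X ^ Suc k) oo - fps_X) * ((\<Prod>k<N. 1 + fps_X ^ Suc k) oo fps_X ^ 2) =
    ((\<Prod>k<N. 1 - fps_X ^ Suc k) oo fps_X ^ 2) * (\<Prod>k<2*N. 1 + fps_X ^ Suc k :: 'a fps)" for N
  proof -
    have "(\<Prod>k<2*N. 1 - (- x) ^ Suc k) * (\<Prod>k<N. 1 + (x ^ 2) ^ Suc k) =
      (\<Prod>k<N. 1 - (x ^ 2) ^ Suc k) * (\<Prod>k<2*N. 1 + x ^ Suc k)" for x :: "'a fps"
    proof (induction N)
      case (Suc N)
      have e: "(- x) ^ Suc (2 * N) = - (x * (x\<^sup>2) ^ N)" "(- x) ^ Suc (Suc (2 * N)) = (x\<^sup>2) ^ Suc N"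
        "x ^ Suc (2 * N) = x * (x\<^sup>2) ^ N" "x ^ Suc (Suc (2 * N)) = (x\<^sup>2) ^ Suc N"
        by (simp_all add: power_mult power2_eq_square)
      have "2 * Suc N = Suc (Suc (2 * N))" by simp
      show ?case
        unfolding prod.lessThan_Suc \<open>2 * Suc N = _\<close> e diff_minus_eq_add
        using arg_cong[OF Suc, of "\<lambda>w. w * ((1 - (x\<^sup>2) ^ Suc N) * (1 + x * (x\<^sup>2) ^ N) * (1 + (x\<^sup>2) ^ Suc N))"]
        by (simp only: mult_ac)
    qed simp
    moreover have "fps_nth (- fps_X :: 'a fps) 0 = 0" "fps_nth (fps_X\<^sup>2 :: 'a fps) 0 = 0" by simp_all
    ultimately show ?thesis
      by (simp only: prod_X_power_compose)
  qed
  moreover have "(\<lambda>N. ((\<Prod>k<N. 1 - fps_X ^ Suc k) oo fps_X ^ 2) * (\<Prod>k<2*N. 1 + fps_X ^ Suc k :: 'a fps))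
      \<longlonglongrightarrow> (euler_minus oo fps_X ^ 2) * euler_plus"
    by (intro tendsto_mult_fps tendsto_compose_fps euler_minus_tendsto
      filterlim_compose[OF euler_plus_tendsto *])
  ultimately show "(\<lambda>N. ((\<Prod>k<2*N. 1 - fps_X ^ Suc k) oo - fps_X) * ((\<Prod>k<N. 1 + fps_X ^ Suc k) oo fps_X ^ 2 :: 'a fps))
      \<longlonglongrightarrow> (euler_minus oo fps_X ^ 2) * euler_plus"
    by (simp only:)
qed

text \<open>Shanks's finite form of Gauss's identity; the difference of consecutive right-hand sides telescopes.\<close>

lemma gauss_finite:
  fixes x :: "'a::comm_ring_1"
  shows "(1 + 2 * (\<Sum>s=1..n. (-1) ^ s * x ^ s\<^sup>2)) * (\<Prod>k=1..n. 1 + x ^ k) =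
    (\<Sum>s\<le>n. (-1) ^ s * x ^ (s * Suc n) * (\<Prod>k=Suc s..n. 1 - x ^ k) * (\<Prod>k<s. 1 + x ^ k))"
proof (induction n)
  case (Suc n)
  define a where "a s = (\<Prod>k=Suc s..n. 1 - x ^ k) * (\<Prod>k<s. 1 + x ^ k)" for s
  \<comment> \<open>The antidifference: the summand for n+1 equals 1 + x^(n+1) times the summand for
    n, plus b(s+1) - b(s). The factor 1 - x^s, present in \<open>b\<close> but not in
    \<open>a\<close>, makes b(0) vanish.\<close>
  define b where "b s = (-1) ^ s * x ^ (s * Suc n) * (\<Prod>k=s..n. 1 - x ^ k) * (\<Prod>k<s. 1 + x ^ k)" for s
  have step: "(-1) ^ s * x ^ (s * Suc (Suc n)) * (\<Prod>k=Suc s..Suc n. 1 - x ^ k) * (\<Prod>k<s. 1 + x ^ k) =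
      (1 + x ^ Suc n) * ((-1) ^ s * x ^ (s * Suc n) * a s) + (b (Suc s) - b s)" if "s \<le> n" for s
  proof -
    have 1: "(\<Prod>k=Suc s..Suc n. 1 - x ^ k) = (\<Prod>k=Suc s..n. 1 - x ^ k) * (1 - x ^ Suc n)"
      using that by (subst prod.cl_ivl_Suc) auto
    have 2: "(\<Prod>k=s..n. 1 - x ^ k) = (1 - x ^ s) * (\<Prod>k=Suc s..n. 1 - x ^ k)"
      using that by (rule prod.atLeast_Suc_atMost)
    have "x ^ (s * Suc (Suc n)) = x ^ (s * Suc n) * x ^ s"
      "x ^ (Suc s * Suc n) = x ^ (s * Suc n) * x ^ Suc n"
      by (simp_all add: algebra_simps flip: power_add)
    then show ?thesis
      unfolding a_def b_def 1 2 prod.lessThan_Suc by (simp add: algebra_simps)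
  qed
  have b0: "b 0 = 0"
    unfolding b_def by (subst prod.atLeast_Suc_atMost) auto
  \<comment> \<open>The 2 in front of the theta sum comes from the factor 1 + x^0; b(n+1) supplies
    the new theta term.\<close>
  have "(\<Prod>k<Suc n. 1 + x ^ k) = 2 * (\<Prod>k=1..n. 1 + x ^ k)"
    by (subst prod.lessThan_Suc_shift) (simp add: prod.shift_bounds_Suc_ivl
      atLeast0LessThan prod.atLeast1_atMost_eq)
  then have bn: "b (Suc n) = 2 * (-1) ^ Suc n * x ^ (Suc n)\<^sup>2 * (\<Prod>k=1..n. 1 + x ^ k)"
    unfolding b_def by (simp add: power2_eq_square)
  have IH: "(\<Sum>s\<le>n. (-1) ^ s * x ^ (s * Suc n) * a s) =
      (1 + 2 * (\<Sum>s=1..n. (-1) ^ s * x ^ s\<^sup>2)) * (\<Prod>k=1..n. 1 + x ^ k)"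
    unfolding Suc a_def by (simp add: mult.assoc)
  have last: "(-1) ^ Suc n * x ^ (Suc n * Suc (Suc n)) * (\<Prod>k<Suc n. 1 + x ^ k) = x ^ Suc n * b (Suc n)"
  proof -
    have "Suc n * Suc (Suc n) = Suc n + Suc n * Suc n" by simp
    then show ?thesis
      unfolding b_def by (simp only: power_add) (simp add: mult_ac)
  qed
  have "(\<Sum>s\<le>Suc n. (-1) ^ s * x ^ (s * Suc (Suc n)) * (\<Prod>k=Suc s..Suc n. 1 - x ^ k) * (\<Prod>k<s. 1 + x ^ k)) =
      (\<Sum>s\<le>n. (1 + x ^ Suc n) * ((-1) ^ s * x ^ (s * Suc n) * a s) + (b (Suc s) - b s)) + x ^ Suc n * b (Suc n)"
    using last by (subst sum.atMost_Suc, intro arg_cong2[where f="(+)"] sum.cong step) auto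
  also have "\<dots> = (1 + x ^ Suc n) * ((1 + 2 * (\<Sum>s=1..n. (-1) ^ s * x ^ s\<^sup>2)) * (\<Prod>k=1..n. 1 + x ^ k))
      + (1 + x ^ Suc n) * b (Suc n)"
    using b0 unfolding sum.distrib sum_distrib_left[symmetric] IH
    by (simp only: lessThan_Suc_atMost[symmetric] sum_lessThan_telescope) (simp add: algebra_simps)
  also have "\<dots> = (1 + 2 * (\<Sum>s=1..Suc n. (-1) ^ s * x ^ s\<^sup>2)) * (\<Prod>k=1..Suc n. 1 + x ^ k)"
    unfolding bn by (simp only: prod.cl_ivl_Suc sum.cl_ivl_Suc) (simp add: algebra_simps)
  finally show ?case ..
qed simp

text \<open>The series of q^(k^2) over all integers k. Defining it by counting square roots makes
  \<open>theta\<close> squared count sums of two squares, so that identities can be proved by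
  bijections.\<close>

definition theta :: "'a::field_char_0 fps"
  where "theta = Abs_fps (\<lambda>n. of_nat (card {k::int. k\<^sup>2 = int n}))"

lemma card_int_sqrt:
  "card {k::int. k\<^sup>2 = int n} = (if n = 0 then 1 else if \<exists>s. n = s\<^sup>2 then 2 else 0)"
proof (cases "\<exists>s. n = s\<^sup>2")
  case True
  then obtain s where s: "n = s\<^sup>2" by auto
  have "{k::int. k\<^sup>2 = int n} = {int s, - int s}"
    unfolding s by (auto simp: power2_eq_iff)
  then show ?thesis using s by (auto simp: card_insert_if)
next
  case False
  have "{k::int. k\<^sup>2 = int n} = {}"
  proof safe
    fix k :: int assume "k\<^sup>2 = int n"
    then have "int ((nat \<bar>k\<bar>)\<^sup>2) = int n" by simp
    then show "k \<in> {}" using False by (metis of_nat_eq_iff)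
  qed
  moreover have "n \<noteq> 0" using False by (metis zero_power2)
  ultimately show ?thesis using False by auto
qed

text \<open>Pairing k with -k gives the 2, and s and s^2 have the same parity, which gives the sign.
  The partial sums are the left factor in the finite Gauss identity.\<close>

lemma theta_uminus_tendsto:
  "(\<lambda>n. 1 + 2 * (\<Sum>s=1..n. (-1) ^ s * fps_X ^ s\<^sup>2)) \<longlonglongrightarrow> (theta oo - fps_X :: 'a::field_char_0 fps)"
proof (rule tendsto_fpsI)
  fix m :: nat
  have "fps_nth (1 + 2 * (\<Sum>s=1..n. (-1) ^ s * fps_X ^ s\<^sup>2)) m = fps_nth (theta oo - fps_X :: 'a fps) m"
    if "m \<le> n" for n
  proof -
    have "fps_nth ((-1) ^ s * fps_X ^ s\<^sup>2 :: 'a fps) m = (if m = s\<^sup>2 then (-1) ^ s else 0)" for s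
      by (cases "even s") (auto simp: fps_X_power_iff)
    then have eq: "fps_nth (1 + 2 * (\<Sum>s=1..n. (-1) ^ s * fps_X ^ s\<^sup>2) :: 'a fps) m =
        (if m = 0 then 1 else 0) + 2 * (\<Sum>s=1..n. if m = s\<^sup>2 then (-1) ^ s else 0)"
      by (simp add: fps_sum_nth fps_numeral_fps_const)
    show ?thesis
    proof (cases "\<exists>t. m = t\<^sup>2")
      case False
      then have "m \<noteq> 0" by (metis zero_power2)
      then show ?thesis
        unfolding eq using False by (simp add: fps_compose_uminus' theta_def card_int_sqrt)
    next
      case True
      then obtain t where t: "m = t\<^sup>2" by auto
      have "t \<le> n" using that t by (metis le_square le_trans power2_eq_square)
      have "(\<Sum>s=1..n. if m = s\<^sup>2 then (-1) ^ s else (0::'a)) = (\<Sum>s=1..n. if s = t then (-1) ^ s else 0)"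
        by (rule sum.cong) (auto simp: t)
      also have "\<dots> = (if m = 0 then 0 else (-1) ^ t)"
        using \<open>t \<le> n\<close> t by (auto simp: sum.delta')
      finally show ?thesis
        unfolding eq using t by (auto simp: fps_compose_uminus' theta_def card_int_sqrt uminus_power_if)
    qed
  qed
  then show "\<forall>\<^sub>F n in sequentially. fps_nth (1 + 2 * (\<Sum>s=1..n. (-1) ^ s * fps_X ^ s\<^sup>2)) m =
      fps_nth (theta oo - fps_X :: 'a fps) m"
    by (intro eventually_sequentiallyI)
qed

text \<open>The limit of the finite Gauss identity: the summands with s > 0 are divisible by
  q^(s(n+1)) and disappear, and the summand s = 0 is the partial product of
  \<open>euler_minus\<close>.\<close>

lemma theta_uminus_mult_plus:
  "(theta oo - fps_X) * euler_plus = (euler_minus :: 'a::field_char_0 fps)"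
proof (rule LIMSEQ_unique)
  define W :: "nat \<Rightarrow> 'a fps" where "W = (\<lambda>n. \<Sum>s\<le>n. (-1) ^ s * fps_X ^ (s * Suc n) *
    (\<Prod>k=Suc s..n. 1 - fps_X ^ k) * (\<Prod>k<s. 1 + fps_X ^ k))"
  have sh: "(\<Prod>k=1..n. f k) = (\<Prod>k<n. f (Suc k))" for f :: "nat \<Rightarrow> 'a fps" and n
    by (simp add: prod.atLeast1_atMost_eq)
  have "(\<lambda>n. (1 + 2 * (\<Sum>s=1..n. (-1) ^ s * fps_X ^ s\<^sup>2)) * (\<Prod>k<n. 1 + fps_X ^ Suc k))
      \<longlonglongrightarrow> (theta oo - fps_X) * (euler_plus :: 'a fps)"
    by (intro tendsto_mult_fps theta_uminus_tendsto euler_plus_tendsto)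
  then show "W \<longlonglongrightarrow> (theta oo - fps_X) * euler_plus"
    unfolding W_def gauss_finite[symmetric] sh .
  show "W \<longlonglongrightarrow> euler_minus"
  proof (rule tendsto_fpsI)
    fix m
    have "fps_nth (W n) m = fps_nth (\<Prod>k<n. 1 - fps_X ^ Suc k) m" if "m \<le> n" for n
    proof -
      have "fps_nth ((-1) ^ s * fps_X ^ (s * Suc n) * (\<Prod>k=Suc s..n. 1 - fps_X ^ k) * (\<Prod>k<s. 1 + fps_X ^ k) :: 'a fps) m = 0"
        if "s > 0" for s
      proof -
        have "m < s * Suc n" using \<open>m \<le> n\<close> that
          by (cases s) auto
        then show ?thesis
          by (subst mult.assoc, subst mult.commute[of "(-1) ^ s"], subst mult.assoc)
             (simp only: fps_X_power_mult_nth if_True)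
      qed
      then have "fps_nth (W n) m = (\<Sum>s\<le>n. if s = 0 then fps_nth (\<Prod>k=1..n. 1 - fps_X ^ k) m else 0)"
        unfolding W_def fps_sum_nth by (intro sum.cong) auto
      also have "\<dots> = fps_nth (\<Prod>k=1..n. 1 - fps_X ^ k) m"
        by (simp add: sum.delta')
      finally show ?thesis unfolding sh .
    qed
    then have "\<forall>\<^sub>F n in sequentially. fps_nth (W n) m = fps_nth (\<Prod>k<n. 1 - fps_X ^ Suc k) m"
      by (intro eventually_sequentiallyI)
    moreover have "\<forall>\<^sub>F n in sequentially. fps_nth (\<Prod>k<n. 1 - fps_X ^ Suc k) m = fps_nth euler_minus m"
      using euler_minus_tendsto unfolding tendsto_fps_iff by blast
    ultimately show "\<forall>\<^sub>F n in sequentially. fps_nth (W n) m = fps_nth euler_minus m"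
      by eventually_elim simp
  qed
qed

section \<open>The modular equation\<close>

lemma finite_int_sqrt: "finite {k::int. k\<^sup>2 = int n}"
proof (rule finite_subset)
  show "{k::int. k\<^sup>2 = int n} \<subseteq> {- int n..int n}"
  proof safe
    fix k :: int assume k: "k\<^sup>2 = int n"
    have "\<bar>k\<bar> \<le> k\<^sup>2"
      by (metis abs_ge_zero power2_abs self_le_power zero_less_numeral abs_le_zero_iff
        int_one_le_iff_zero_less linorder_not_le order.trans zero_le_power2)
    then show "k \<in> {- int n..int n}" using k by auto
  qed
qed simp

lemma theta_power2_nth:
  "fps_nth (theta\<^sup>2 :: 'a::field_char_0 fps) n = of_nat (card {(a::int, b::int). a\<^sup>2 + b\<^sup>2 = int n})"
proof -
  define R :: "nat \<Rightarrow> int set" where "R i = {k. k\<^sup>2 = int i}" for i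
  have fin: "finite (R i)" for i
    unfolding R_def by (rule finite_int_sqrt)
  have "{(a, b). a\<^sup>2 + b\<^sup>2 = int n} = (\<Union>i\<in>{0..n}. R i \<times> R (n - i))"
  proof safe
    fix a b :: int assume ab: "a\<^sup>2 + b\<^sup>2 = int n"
    have "nat (a\<^sup>2) \<le> n"
      using ab by (smt (verit) nat_le_iff zero_le_power2)
    moreover have "a \<in> R (nat (a\<^sup>2))" "b \<in> R (n - nat (a\<^sup>2))"
      using ab \<open>nat (a\<^sup>2) \<le> n\<close> by (auto simp: R_def of_nat_diff)
    ultimately show "(a, b) \<in> (\<Union>i\<in>{0..n}. R i \<times> R (n - i))" by auto
  qed (auto simp: R_def of_nat_diff)
  then have "card {(a, b). a\<^sup>2 + b\<^sup>2 = int n} = (\<Sum>i\<in>{0..n}. card (R i \<times> R (n - i)))"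
    by (simp only:) (rule card_UN_disjoint, auto simp: fin, auto simp: R_def)
  then show ?thesis
    by (simp add: power2_eq_square fps_mult_nth theta_def card_cartesian_product R_def)
qed

text \<open>Up to order of coordinates, (a, b) -> (a + b, a - b) is multiplication by 1 + i on the
  Gaussian integers, which doubles the norm. It is onto because c^2 + d^2 even forces c and d to
  have the same parity.\<close>

lemma theta_power2_nth_double:
  "fps_nth (theta\<^sup>2 :: 'a::field_char_0 fps) (2 * n) = fps_nth (theta\<^sup>2) n"
proof -
  have "bij_betw (\<lambda>(a, b). (a + b, a - b)) {(a::int, b::int). a\<^sup>2 + b\<^sup>2 = int n}
      {(a, b). a\<^sup>2 + b\<^sup>2 = int (2 * n)}"
  proof (rule bij_betwI')
    fix p assume "p \<in> {(a::int, b::int). a\<^sup>2 + b\<^sup>2 = int (2 * n)}"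
    then obtain c d where p: "p = (c, d)" and cd: "c\<^sup>2 + d\<^sup>2 = 2 * int n" by auto
    then have "even (c\<^sup>2 + d\<^sup>2)" by simp
    then have "even (c + d)" by simp
    then obtain a where "c + d = 2 * a" by (rule evenE)
    then have c: "c = a + (c - a)" and d: "d = a - (c - a)" by auto
    define b where "b = c - a"
    have "a\<^sup>2 + b\<^sup>2 = int n"
      using cd c d by (simp add: b_def[symmetric] power2_eq_square algebra_simps)
    then show "\<exists>x\<in>{(a, b). a\<^sup>2 + b\<^sup>2 = int n}. p = (case x of (a, b) \<Rightarrow> (a + b, a - b))"
      using c d by (intro bexI[of _ "(a, b)"]) (auto simp: p b_def)
  qed (auto simp: power2_eq_square algebra_simps)
  then show ?thesis
    unfolding theta_power2_nth by (simp only: bij_betw_same_card)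
qed

text \<open>The sum doubles the even coefficients and cancels the odd ones; the number of
  representations of 2n as a sum of two squares equals that of n.\<close>

lemma theta_landen:
  "theta\<^sup>2 + (theta oo - fps_X)\<^sup>2 = 2 * (theta oo fps_X ^ 2 :: 'a::field_char_0 fps)\<^sup>2"
proof (rule fps_ext)
  fix n
  have 1: "(theta oo - fps_X)\<^sup>2 = (theta\<^sup>2 oo - fps_X :: 'a fps)"
    "(theta oo fps_X ^ 2)\<^sup>2 = (theta\<^sup>2 oo fps_X ^ 2 :: 'a fps)"
    by (simp_all add: fps_compose_power)
  have "fps_nth (2 * F) n = 2 * fps_nth F n" for F :: "'a fps"
    by (simp add: fps_numeral_fps_const)
  then show "fps_nth (theta\<^sup>2 + (theta oo - fps_X)\<^sup>2) n = fps_nth (2 * (theta oo fps_X ^ 2 :: 'a fps)\<^sup>2) n"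
    unfolding 1 unfolding fps_compose_uminus' fps_add_nth fps_nth_compose_X_power
    by (cases "even n") (auto elim!: evenE simp: fps_nth_compose_X_power theta_power2_nth_double)
qed

text \<open>Subtracting the equations gives (A - B)(A + B) = K (A - B)(q^2), where A + B has order
  1. If A - B had order d, then d + 1 = ord K + 2d, so d \<le> 1; but the first two coefficients of
  A - B vanish.\<close>

lemma fps_square_functional_unique:
  fixes A B K :: "'a::field_char_0 fps"
  assumes "A\<^sup>2 = K * (A oo fps_X ^ 2)" "B\<^sup>2 = K * (B oo fps_X ^ 2)"
    and "fps_nth A 0 = 0" "fps_nth B 0 = 0" "fps_nth A 1 = fps_nth B 1" "fps_nth B 1 \<noteq> 0"
  shows "A = B"
proof (rule ccontr)
  assume "A \<noteq> B"
  then have nz: "A - B \<noteq> 0" by simp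
  have 1: "fps_nth (A + B) 1 \<noteq> 0"
    using assms by (simp flip: mult_2)
  then have nz': "A + B \<noteq> 0" by (metis fps_zero_nth)
  have sd: "subdegree (A + B) = 1"
    using assms 1 by (intro subdegreeI) auto
  have eq: "(A - B) * (A + B) = K * ((A - B) oo fps_X ^ 2)"
    unfolding fps_compose_sub_distrib right_diff_distrib assms(1,2)[symmetric]
    by (simp add: power2_eq_square algebra_simps)
  then have "K \<noteq> 0" "(A - B) oo fps_X ^ 2 \<noteq> 0"
    using nz nz' by auto
  then have "subdegree (A - B) + 1 = subdegree K + subdegree (A - B) * 2"
    using arg_cong[OF eq, of subdegree] nz nz' sd by simp
  moreover have "subdegree (A - B) \<ge> 2"
  proof (rule subdegree_geI[OF nz])
    fix i :: nat assume "i < 2"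
    then have "i = 0 \<or> i = 1" by auto
    then show "fps_nth (A - B) i = 0" using assms by auto
  qed
  ultimately show False by simp
qed

section \<open>Product formulas and Jacobi's quartic identity\<close>

lemma fps_X_compose_simps:
  "fps_X ^ 2 oo - fps_X = (fps_X ^ 2 :: 'a::field_char_0 fps)"
  "- fps_X oo - fps_X = (fps_X :: 'a fps)"
  by (simp_all add: fps_X_power_compose fps_compose_uminus)

text \<open>Everything is expressed through E and P without division: theta(-q) = E/P and theta(q) =
  E P^3 / P(q^2)^2. The second relation is Euler's theorem that P is the inverse of the product of 1
  - q^k over odd k, in disguise.\<close>

lemma euler_compose_simps:
  fixes E P :: "'a::field_char_0 fps"
  defines "E \<equiv> euler_minus" and "P \<equiv> euler_plus"
  shows "E oo fps_X ^ 2 = E * P"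
    and "P * (P oo - fps_X) = P oo fps_X ^ 2"
    and "(theta oo - fps_X) * P = E"
    and "theta * (P oo fps_X ^ 2)\<^sup>2 = E * P ^ 3"
proof -
  define Pm Em P2 where "Pm = P oo - fps_X" and "Em = E oo - fps_X" and "P2 = P oo fps_X ^ 2"
  have nz: "E \<noteq> 0" "P \<noteq> 0"
    using euler_nth_0 unfolding E_def P_def by (metis fps_zero_nth zero_neq_one)+
  show E2: "E oo fps_X ^ 2 = E * P"
    unfolding E_def P_def by (rule euler_minus_mult_plus[symmetric])
  show T: "(theta oo - fps_X) * P = E"
    unfolding E_def P_def by (rule theta_uminus_mult_plus)
  have Em: "Em * P2 = E * P ^ 2"
    using euler_minus_uminus[where ?'a='a] E2
    unfolding E_def[symmetric] P_def[symmetric] Em_def P2_def by (simp add: power2_eq_square mult.assoc)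
  have "Em * Pm = (E * P) oo - fps_X"
    unfolding Em_def Pm_def by (simp add: fps_compose_mult_distrib)
  \<comment> \<open>E P = E(q^2) is even, hence fixed by q -> -q.\<close>
  also have "\<dots> = E * P"
    unfolding E2[symmetric] by (simp add: fps_X_compose_simps flip: fps_compose_assoc)
  finally have EmPm: "Em * Pm = E * P" .
  have "(E * P) * (P * Pm) = Em * P2 * Pm"
    unfolding Em by (simp add: power2_eq_square mult_ac)
  also have "\<dots> = (E * P) * P2"
    using EmPm by (simp add: mult_ac)
  finally show PPm: "P * (P oo - fps_X) = P oo fps_X ^ 2"
    using nz unfolding Pm_def P2_def by simp
  have "theta * Pm = (theta oo - fps_X) * P oo - fps_X"
    unfolding Pm_def
    by (simp add: fps_compose_mult_distrib fps_X_compose_simps flip: fps_compose_assoc)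
  then have TPm: "theta * Pm = Em"
    unfolding T Em_def .
  have "theta * P2\<^sup>2 = theta * Pm * P * P2"
    using PPm by (simp add: P2_def Pm_def power2_eq_square mult_ac)
  also have "\<dots> = E * P ^ 3"
    unfolding TPm using Em by (simp add: mult_ac power2_eq_square power3_eq_cube)
  finally show "theta * (P oo fps_X ^ 2)\<^sup>2 = E * P ^ 3"
    unfolding P2_def .
qed

text \<open>Both sides of Jacobi's quartic identity solve \<open>A(q)\<^sup>2 = 16 \<theta>(q\<^sup>2)\<^sup>4 A(q\<^sup>2)\<close>.\<close>

lemma jacobi_quartic:
  "theta ^ 4 - (theta oo - fps_X) ^ 4 =
    16 * fps_X * euler_minus ^ 4 * euler_plus ^ 4 * (euler_plus oo fps_X ^ 2 :: 'a::field_char_0 fps) ^ 8"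
  (is "?D = ?Q")
proof (rule fps_square_functional_unique)
  define E P :: "'a fps" where "E = euler_minus" and "P = euler_plus"
  define P2 where "P2 = P oo fps_X ^ 2"
  define P4 where "P4 = P2 oo fps_X ^ 2"
  define T Tm T2 Tm2 :: "'a fps" where "T = theta" and "Tm = theta oo - fps_X"
    and "T2 = theta oo fps_X ^ 2" and "Tm2 = (theta oo - fps_X) oo fps_X ^ 2"
  note rels = euler_compose_simps[where ?'a='a, folded E_def P_def, folded Tm_def P2_def, folded T_def]
  have nz: "E \<noteq> 0" "P \<noteq> 0" "P2 \<noteq> 0" "P4 \<noteq> 0"
    using euler_nth_0 unfolding E_def P_def P2_def P4_def
    by (metis fps_zero_nth zero_neq_one fps_compose_nth_0)+
  have T2: "T2 * P4\<^sup>2 = E * P * P2 ^ 3"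
    using arg_cong[OF rels(4), of "\<lambda>F. F oo fps_X ^ 2"] rels(1)
    unfolding T2_def P4_def T_def
    by (simp add: fps_compose_mult_distrib P2_def flip: fps_compose_power)
  have Tm2: "Tm2 * P2 = E * P"
    using arg_cong[OF rels(3), of "\<lambda>F. F oo fps_X ^ 2"] rels(1)
    unfolding Tm2_def Tm_def T_def by (simp add: fps_compose_mult_distrib P2_def)
  have sum: "T\<^sup>2 + Tm\<^sup>2 = 2 * T2\<^sup>2"
    unfolding T_def Tm_def T2_def by (rule theta_landen)
  \<comment> \<open>Together with \<open>sum\<close> this is the arithmetic-geometric mean: passing
    from q to q^2 replaces the pair (T^2, Tm^2) by its arithmetic and geometric means.\<close>
  have "(P2\<^sup>2 * P) * (T * Tm) = (T * P2\<^sup>2) * (Tm * P)"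
    by (simp add: mult_ac)
  also have "\<dots> = P * (E * P)\<^sup>2"
    unfolding rels(3,4) by (simp add: power2_eq_square power3_eq_cube mult_ac)
  also have "\<dots> = (P2\<^sup>2 * P) * Tm2\<^sup>2"
    unfolding Tm2[symmetric] by (simp add: power2_eq_square mult_ac)
  finally have prod: "T * Tm = Tm2\<^sup>2"
    using nz by simp
  have "(T ^ 4 - Tm ^ 4)\<^sup>2 = (T\<^sup>2 + Tm\<^sup>2)\<^sup>2 * ((T\<^sup>2 + Tm\<^sup>2)\<^sup>2 - 4 * (T * Tm)\<^sup>2)"
    by algebra
  also have "\<dots> = (16 * T2 ^ 4) * (T2 ^ 4 - Tm2 ^ 4)"
    unfolding sum prod by algebra
  finally show "?D\<^sup>2 = (16 * T2 ^ 4) * (?D oo fps_X ^ 2)"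
    unfolding T_def[symmetric] Tm_def[symmetric]
    by (simp add: fps_compose_sub_distrib T2_def Tm2_def T_def Tm_def flip: fps_compose_power)
  have Q2: "?Q oo fps_X ^ 2 = 16 * fps_X ^ 2 * (E * P) ^ 4 * P2 ^ 4 * P4 ^ 8"
    unfolding P4_def P2_def rels(1)[symmetric] unfolding E_def P_def
    by (simp add: fps_compose_mult_distrib flip: fps_compose_power)
  \<comment> \<open>The factor \<open>P4 ^ 8\<close> allows \<open>T2\<close> to be eliminated
    through its product formula \<open>T2\<close>, which is stated for
    \<open>T2 * P4\<^sup>2\<close>.\<close>
  have "P4 ^ 8 * ((16 * T2 ^ 4) * (?Q oo fps_X ^ 2)) =
      256 * fps_X ^ 2 * (E * P) ^ 4 * P2 ^ 4 * P4 ^ 8 * (T2 * P4\<^sup>2) ^ 4"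
    unfolding Q2 by algebra
  also have "\<dots> = P4 ^ 8 * ?Q\<^sup>2"
    unfolding T2 E_def[symmetric] P_def[symmetric] P2_def[symmetric] by algebra
  finally show "?Q\<^sup>2 = (16 * T2 ^ 4) * (?Q oo fps_X ^ 2)"
    using nz by simp
  have "\<exists>s. (1::nat) = s\<^sup>2" by (rule exI[of _ 1]) simp
  then have t0: "fps_nth (theta :: 'a fps) 0 = 1" "fps_nth (theta :: 'a fps) 1 = 2"
    unfolding theta_def fps_nth_Abs_fps card_int_sqrt by (simp_all only: if_True) simp_all
  then have t1: "fps_nth (theta oo - fps_X :: 'a fps) 0 = 1" "fps_nth (theta oo - fps_X :: 'a fps) 1 = -2"
    by (simp_all add: fps_compose_uminus')
  define G :: "'a fps" where "G = fps_const 16 * euler_minus ^ 4 * euler_plus ^ 4 * (euler_plus oo fps_X ^ 2) ^ 8"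
  have Q: "?Q = fps_X * G"
    unfolding G_def by (simp add: fps_numeral_fps_const mult_ac)
  have "fps_nth G 0 = 16"
    unfolding G_def by (simp add: fps_mult_nth_0 fps_power_zeroth_eq_one euler_nth_0)
  then have Q1: "fps_nth ?Q 1 = 16"
    unfolding Q by simp
  show "fps_nth ?D 0 = 0"
    using t0 t1 by (simp add: fps_power_zeroth_eq_one)
  show "fps_nth ?Q 0 = 0"
    unfolding Q by simp
  have "fps_nth ?D 1 = 16"
    unfolding fps_sub_nth fps_power_first_eq[OF t0(1)] fps_power_first_eq[OF t1(1)] t0 t1 by simp
  then show "fps_nth ?D 1 = fps_nth ?Q 1" "fps_nth ?Q 1 \<noteq> 0"
    unfolding Q1 by simp_all
qed

text \<open>\<open>Delta\<close> is q E^24, and E(q^2) = E P; the quotient leaves q P^24.\<close>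

lemma form_f_eq: "form_f = fps_X * (euler_plus :: 'a::field_char_0 fps) ^ 24"
proof -
  have "(1 - fps_X ^ (n + 1)) ^ 24 \<noteq> (0 :: 'a fps)" for n
    using Delta_factor_nth(1)[where ?'a='a, of n] by (metis fps_zero_nth zero_neq_one)
  then have "raw_has_prod (\<lambda>n. (1 - fps_X ^ (n + 1)) ^ 24) 0 (\<Prod>n. (1 - fps_X ^ (n + 1)) ^ 24 :: 'a fps)"
    using Delta_has_prod[where ?'a='a] unfolding has_prod_def by fast
  then have "(\<lambda>n. (\<Prod>k<n. 1 - fps_X ^ Suc k) ^ 24) \<longlonglongrightarrow> (\<Prod>n. (1 - fps_X ^ (n + 1)) ^ 24 :: 'a fps)"
    unfolding raw_has_prod_def prod_power_distrib[symmetric]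
    by (subst LIMSEQ_lessThan_iff_atMost) simp
  moreover have "(\<lambda>n. (\<Prod>k<n. 1 - fps_X ^ Suc k :: 'a fps) ^ 24) \<longlonglongrightarrow> euler_minus ^ 24"
    by (intro tendsto_power_fps euler_minus_tendsto)
  ultimately have "(\<Prod>n. (1 - fps_X ^ (n + 1)) ^ 24 :: 'a fps) = euler_minus ^ 24"
    by (rule LIMSEQ_unique)
  then have D: "Delta = fps_X * (euler_minus :: 'a fps) ^ 24"
    unfolding Delta_def by simp
  have "euler_minus \<noteq> (0 :: 'a fps)"
    using euler_nth_0(2) by (metis fps_zero_nth zero_neq_one)
  then have "Delta \<noteq> (0 :: 'a fps)"
    unfolding D by simp
  moreover have "Delta oo fps_X ^ 2 = (fps_X * euler_plus ^ 24) * (Delta :: 'a fps)"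
    unfolding D by (simp add: fps_compose_mult_distrib power2_eq_square mult_ac
      power_mult_distrib euler_minus_mult_plus[symmetric, unfolded power2_eq_square] flip: fps_compose_power)
  ultimately show ?thesis
    unfolding form_f_def by simp
qed

text \<open>The product is P(q) P(-q) = P(q^2) raised to the 24th power. For the sum, Jacobi's
  identity becomes x^2 = y + 16 q x y^2 with x = P^8 and y = P(q^2)^8, and the rest is
  algebra.\<close>

lemma form_f_modular:
  fixes f :: "'a::field_char_0 fps"
  defines "f \<equiv> form_f"
  shows "f * (f oo - fps_X) = - (f oo fps_X ^ 2)"
    and "f + (f oo - fps_X) = 48 * (f oo fps_X ^ 2) + 4096 * (f oo fps_X ^ 2)\<^sup>2"
proof -
  define E P P2 Pm :: "'a fps" where "E = euler_minus" and "P = euler_plus"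
    and "P2 = euler_plus oo fps_X ^ 2" and "Pm = euler_plus oo - fps_X"
  note rels = euler_compose_simps[where ?'a='a, folded E_def P_def P2_def Pm_def, folded P2_def Pm_def]
  have nz: "E \<noteq> 0" "P \<noteq> 0" "P2 \<noteq> 0"
    using euler_nth_0 unfolding E_def P_def P2_def
    by (metis fps_zero_nth zero_neq_one fps_compose_nth_0)+
  have f: "f = fps_X * P ^ 24" "f oo - fps_X = - fps_X * Pm ^ 24" "f oo fps_X ^ 2 = fps_X ^ 2 * P2 ^ 24"
    unfolding f_def form_f_eq P_def Pm_def P2_def
    by (simp_all add: fps_compose_mult_distrib flip: fps_compose_power)
  show "f * (f oo - fps_X) = - (f oo fps_X ^ 2)"
    unfolding f(2,3) unfolding f(1) rels(2)[unfolded Pm_def[symmetric] P2_def[symmetric], symmetric]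
    by (simp add: power_mult_distrib power2_eq_square mult_ac)
  have "E ^ 4 * P ^ 16 = P ^ 4 * P2 ^ 8 * (theta ^ 4)"
    using arg_cong[OF rels(4), of "\<lambda>F. F ^ 4 * P ^ 4"]
    by (simp add: power_mult_distrib mult_ac flip: power_mult power_add)
  moreover have "E ^ 4 * P2 ^ 8 = P ^ 4 * P2 ^ 8 * (theta oo - fps_X) ^ 4"
    using arg_cong[OF rels(3), of "\<lambda>F. F ^ 4 * P2 ^ 8"]
    by (simp only: power_mult_distrib mult_ac)
  ultimately have "E ^ 4 * (P ^ 16 - P2 ^ 8) = P ^ 4 * P2 ^ 8 * (theta ^ 4 - (theta oo - fps_X) ^ 4)"
    by (simp add: right_diff_distrib)
  also have "\<dots> = E ^ 4 * (16 * fps_X * P ^ 8 * P2 ^ 16)"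
    unfolding jacobi_quartic P2_def[symmetric] unfolding E_def[symmetric] P_def[symmetric] by algebra
  finally have "P ^ 16 - P2 ^ 8 = 16 * fps_X * P ^ 8 * P2 ^ 16"
    using nz by simp
  moreover define x y q where "x = P ^ 8" and "y = P2 ^ 8" and "q = (fps_X :: 'a fps)"
  ultimately have xy: "x\<^sup>2 = y + 16 * q * x * y\<^sup>2"
    by (simp add: algebra_simps flip: power_mult)
  \<comment> \<open>With u = x^2 - y = 16 q x y^2 one has x^6 - y^3 = u^3 + 3 x^2 y u, whence 4096 =
    16^3 and 48 = 3 * 16.\<close>
  have "x ^ 6 - y ^ 3 = x ^ 3 * (48 * q * y ^ 3 + 4096 * q ^ 3 * y ^ 6)"
    using xy by algebra
  then have "P ^ 24 * (f + (f oo - fps_X)) = P ^ 24 * (48 * (f oo fps_X ^ 2) + 4096 * (f oo fps_X ^ 2)\<^sup>2)"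
  proof -
    assume a: "x ^ 6 - y ^ 3 = x ^ 3 * (48 * q * y ^ 3 + 4096 * q ^ 3 * y ^ 6)"
    have Pm: "P ^ 24 * Pm ^ 24 = y ^ 3"
      unfolding y_def using rels(2) by (simp add: Pm_def P2_def flip: power_mult power_mult_distrib)
    have P: "P ^ 24 = x ^ 3" "P2 ^ 24 = y ^ 3"
      unfolding x_def y_def by (simp_all flip: power_mult)
    have "P ^ 24 * (f + (f oo - fps_X)) = q * (x ^ 3 * x ^ 3 - P ^ 24 * Pm ^ 24)"
      unfolding f(2) unfolding f(1) P(1)[symmetric] q_def by (simp add: algebra_simps)
    also have "\<dots> = q * (x ^ 3 * (48 * q * y ^ 3 + 4096 * q ^ 3 * y ^ 6))"
      unfolding Pm a[symmetric] by (simp flip: power_add)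
    also have "\<dots> = x ^ 3 * (48 * (q ^ 2 * y ^ 3) + 4096 * (q ^ 2 * y ^ 3)\<^sup>2)"
      by algebra
    finally show ?thesis unfolding f(3) P q_def .
  qed
  then show "f + (f oo - fps_X) = 48 * (f oo fps_X ^ 2) + 4096 * (f oo fps_X ^ 2)\<^sup>2"
    using nz by simp
qed

section \<open>The matrix of U\<close>

lemma form_g_nth: "fps_nth form_g 0 = 0" "fps_nth form_g 1 = 64"
  using form_f_nth by (simp_all add: form_g_def)

text \<open>Both sides are twice the even part of F. For F = g^j the right side is the power sum
  g(q)^j + g(-q)^j, to which Newton's identities apply.\<close>

lemma hecke_U_compose_X_power2:
  "2 * (hecke_U F oo fps_X ^ 2) = F + (F oo - fps_X :: 'a::field_char_0 fps)"
proof (rule fps_ext)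
  fix n
  have "fps_nth (2 * F) n = 2 * fps_nth F n" for F :: "'a fps"
    by (simp add: fps_numeral_fps_const)
  then show "fps_nth (2 * (hecke_U F oo fps_X ^ 2)) n = fps_nth (F + (F oo - fps_X)) n"
    by (cases "even n") (auto elim!: evenE simp: fps_compose_uminus' hecke_U_def fps_nth_compose_X_power)
qed

lemma fps_compose_X_power2_inject:
  "(F oo fps_X ^ 2) = (G oo fps_X ^ 2) \<longleftrightarrow> F = (G :: 'a::field_char_0 fps)"
proof
  assume eq: "F oo fps_X ^ 2 = G oo fps_X ^ 2"
  show "F = G"
  proof (rule fps_ext)
    fix n
    show "fps_nth F n = fps_nth G n"
      using arg_cong[OF eq, of "\<lambda>H. fps_nth H (2 * n)"] by (simp add: fps_nth_compose_X_power)
  qed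
qed simp

lemma hecke_U_eqI:
  fixes F G :: "'a::field_char_0 fps"
  assumes "F + (F oo - fps_X) = 2 * (G oo fps_X ^ 2)"
  shows "hecke_U F = G"
proof -
  have "2 * (hecke_U F oo fps_X ^ 2) = 2 * (G oo fps_X ^ 2)"
    using assms hecke_U_compose_X_power2[of F] by simp
  then show ?thesis
    by (simp add: fps_compose_X_power2_inject)
qed

lemma form_g_modular:
  fixes g :: "'a::field_char_0 fps"
  defines "g \<equiv> form_g"
  shows "g * (g oo - fps_X) = - 64 * (g oo fps_X ^ 2)"
    and "g + (g oo - fps_X) = 48 * (g oo fps_X ^ 2) + 64 * (g oo fps_X ^ 2)\<^sup>2"
proof -
  define f :: "'a fps" where "f = form_f"
  have g: "g = 64 * f"
    unfolding g_def form_g_def f_def by (simp add: fps_numeral_fps_const)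
  then have gc: "g oo - fps_X = 64 * (f oo - fps_X)" "g oo fps_X ^ 2 = 64 * (f oo fps_X ^ 2)"
    by (simp_all add: fps_compose_mult_distrib)
  note f = form_f_modular[where ?'a='a, folded f_def]
  have "g * (g oo - fps_X) = 4096 * (f * (f oo - fps_X))"
    unfolding gc unfolding g by algebra
  then show "g * (g oo - fps_X) = - 64 * (g oo fps_X ^ 2)"
    unfolding f gc by simp
  have "g + (g oo - fps_X) = 64 * (f + (f oo - fps_X))"
    unfolding gc unfolding g by algebra
  then show "g + (g oo - fps_X) = 48 * (g oo fps_X ^ 2) + 64 * (g oo fps_X ^ 2)\<^sup>2"
    unfolding f gc by algebra
qed

text \<open>Newton's recurrence for the power sums of \<open>g(q)\<close> and \<open>g(-q)\<close>.\<close>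

lemma hecke_U_form_g_power_rec:
  fixes g :: "'a::field_char_0 fps"
  defines "g \<equiv> form_g"
  shows "hecke_U (g ^ (j + 2)) = (48 * g + 64 * g\<^sup>2) * hecke_U (g ^ (j + 1)) + 64 * g * hecke_U (g ^ j)"
proof (rule hecke_U_eqI)
  define h y where "h = g oo - fps_X" and "y = g oo fps_X ^ 2"
  have pow: "g ^ m oo - fps_X = h ^ m" for m
    by (simp add: h_def fps_compose_power)
  have U: "2 * (hecke_U (g ^ m) oo fps_X ^ 2) = g ^ m + h ^ m" for m
    unfolding hecke_U_compose_X_power2 pow ..
  have rels: "g * h = - 64 * y" "g + h = 48 * y + 64 * y\<^sup>2"
    using form_g_modular[where ?'a='a] unfolding g_def h_def y_def by simp_all
  have "2 * (((48 * g + 64 * g\<^sup>2) * hecke_U (g ^ (j + 1)) + 64 * g * hecke_U (g ^ j)) oo fps_X ^ 2) =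
      (48 * y + 64 * y\<^sup>2) * (2 * (hecke_U (g ^ (j + 1)) oo fps_X ^ 2)) + 64 * y * (2 * (hecke_U (g ^ j) oo fps_X ^ 2))"
    by (simp add: fps_compose_add_distrib fps_compose_mult_distrib y_def algebra_simps flip: fps_compose_power)
  also have "\<dots> = (g + h) * (g ^ (j + 1) + h ^ (j + 1)) - g * h * (g ^ j + h ^ j)"
    unfolding U rels by simp
  also have "\<dots> = g ^ (j + 2) + h ^ (j + 2)"
    by (simp add: algebra_simps)
  finally show "g ^ (j + 2) + (g ^ (j + 2) oo - fps_X) =
      2 * (((48 * g + 64 * g\<^sup>2) * hecke_U (g ^ (j + 1)) + 64 * g * hecke_U (g ^ j)) oo fps_X ^ 2)"
    unfolding pow ..
qed

lemma hecke_U_form_g: "hecke_U form_g = 24 * form_g + 32 * (form_g :: 'a::field_char_0 fps)\<^sup>2"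
proof (rule hecke_U_eqI)
  show "form_g + (form_g oo - fps_X) = 2 * ((24 * form_g + 32 * (form_g :: 'a fps)\<^sup>2) oo fps_X ^ 2)"
    unfolding form_g_modular
    by (simp add: fps_compose_add_distrib fps_compose_mult_distrib flip: fps_compose_power)
qed

lemma hecke_U_1: "hecke_U 1 = (1 :: 'a::field_char_0 fps)"
  by (rule hecke_U_eqI) simp

text \<open>The reciprocal of the factorial, extended by 0 to the negative integers as \<open>1 / \<Gamma>(n + 1)\<close> is.\<close>

definition inv_fact :: "int \<Rightarrow> 'a::field_char_0"
  where "inv_fact n = (if n < 0 then 0 else 1 / fact (nat n))"

lemma inv_fact_neg [simp]: "n < 0 \<Longrightarrow> inv_fact n = 0"
  by (simp add: inv_fact_def)

lemma inv_fact_of_nat [simp]: "inv_fact (int n) = 1 / fact n"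
  by (simp add: inv_fact_def)

text \<open>Valid at n = 0 too, where both sides vanish. Hence hypergeometric identities hold across
  the boundary of their support without case distinctions.\<close>

lemma inv_fact_diff_1: "inv_fact (n - 1) = of_int n * inv_fact n"
proof (cases "n \<ge> 1")
  case True
  then have "nat n = Suc (nat (n - 1))" by simp
  then have "fact (nat n) = (of_int n * fact (nat (n - 1)) :: 'a)"
    using True by (simp only: fact_Suc) simp
  then show ?thesis
    using True by (simp add: inv_fact_def)
next
  case False
  then show ?thesis by (cases "n = 0") (auto simp: inv_fact_def)
qed

lemma inv_fact_pred: "m = n - 1 \<Longrightarrow> inv_fact m = of_int n * inv_fact n"
  by (simp add: inv_fact_diff_1)

text \<open>The coefficient of g^i in U(g^j) for j \<ge> 1. In column 0 the formula gives 0 although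
  U 1 = 1, so only columns from 1 on are meant.\<close>

definition u_coeff :: "nat \<Rightarrow> nat \<Rightarrow> 'a::field_char_0"
  where "u_coeff i j = 3 / 2 * of_nat j * fact (i + j - 1) * 4 ^ (i + j) *
    inv_fact (2 * int i - int j) * inv_fact (2 * int j - int i)"

lemma u_coeff_eq_0: "2 * i < j \<or> 2 * j < i \<Longrightarrow> u_coeff i j = 0"
  by (auto simp: u_coeff_def)

text \<open>The coefficient form of Newton's recurrence. With \<open>inv_fact\<close> taken at the
  largest arguments that occur and the factorial at the smallest, all four entries are polynomial
  multiples of one quantity \<open>c\<close>.\<close>

lemma u_coeff_rec:
  assumes "j \<ge> 1"
  shows "u_coeff (i + 2) (j + 2) =
    48 * u_coeff (i + 1) (j + 1) + 64 * u_coeff i (j + 1) + (64 * u_coeff (i + 1) j :: 'a::field_char_0)"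
proof -
  define X Y :: 'a where "X = inv_fact (2 * int i + 2 - int j)" and "Y = inv_fact (2 * int j + 2 - int i)"
  define x y :: 'a where "x = of_nat i" and "y = of_nat j"
  have X1: "inv_fact (2 * int i + 1 - int j) = (2 * x + 2 - y) * X"
    unfolding X_def by (subst inv_fact_pred[of _ "2 * int i + 2 - int j"]) (simp_all add: x_def y_def)
  have X2: "inv_fact (2 * int i - int j) = (2 * x + 1 - y) * ((2 * x + 2 - y) * X)"
    unfolding X1[symmetric]
    by (subst inv_fact_pred[of _ "2 * int i + 1 - int j"]) (simp_all add: x_def y_def)
  have X3: "inv_fact (2 * int i - 1 - int j) = (2 * x - y) * ((2 * x + 1 - y) * ((2 * x + 2 - y) * X))"
    unfolding X2[symmetric]
    by (subst inv_fact_pred[of _ "2 * int i - int j"]) (simp_all add: x_def y_def)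
  have Y1: "inv_fact (2 * int j + 1 - int i) = (2 * y + 2 - x) * Y"
    unfolding Y_def by (subst inv_fact_pred[of _ "2 * int j + 2 - int i"]) (simp_all add: x_def y_def)
  have Y2: "inv_fact (2 * int j - int i) = (2 * y + 1 - x) * ((2 * y + 2 - x) * Y)"
    unfolding Y1[symmetric]
    by (subst inv_fact_pred[of _ "2 * int j + 1 - int i"]) (simp_all add: x_def y_def)
  have Y3: "inv_fact (2 * int j - 1 - int i) = (2 * y - x) * ((2 * y + 1 - x) * ((2 * y + 2 - x) * Y))"
    unfolding Y2[symmetric]
    by (subst inv_fact_pred[of _ "2 * int j - int i"]) (simp_all add: x_def y_def)
  define n where "n = i + j - 1"
  have n: "i + j = Suc n" "x + y = of_nat (Suc n)"
    using assms by (simp_all add: n_def x_def y_def flip: of_nat_add)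
  define c :: 'a where "c = 3 / 2 * fact n * 4 ^ n * X * Y"
  have a: "u_coeff (i + 2) (j + 2) = 1024 * (y + 2) * (x + y + 3) * (x + y + 2) * (x + y + 1) * (x + y) * c"
  proof -
    have "i + 2 + (j + 2) - 1 = Suc (Suc (Suc (Suc n)))" "i + 2 + (j + 2) = n + 5"
      "2 * int (i + 2) - int (j + 2) = 2 * int i + 2 - int j"
      "2 * int (j + 2) - int (i + 2) = 2 * int j + 2 - int i"
      using n by simp_all
    then show ?thesis
      unfolding u_coeff_def c_def n(2) by (simp only: X_def[symmetric] Y_def[symmetric]) (simp add: y_def power_add mult_ac add_ac)
  qed
  have b: "u_coeff (i + 1) (j + 1) = 64 * (y + 1) * (x + y + 1) * (x + y) * (2 * x + 2 - y) * (2 * y + 2 - x) * c"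
  proof -
    have "i + 1 + (j + 1) - 1 = Suc (Suc n)" "i + 1 + (j + 1) = n + 3"
      "2 * int (i + 1) - int (j + 1) = 2 * int i + 1 - int j"
      "2 * int (j + 1) - int (i + 1) = 2 * int j + 1 - int i"
      using n by simp_all
    then show ?thesis
      unfolding u_coeff_def c_def n(2) by (simp only: X1 Y1) (simp add: y_def power_add mult_ac add_ac)
  qed
  have d: "u_coeff i (j + 1) = 16 * (y + 1) * (x + y) * (2 * x - y) * (2 * x + 1 - y) * (2 * x + 2 - y) * c"
  proof -
    have "i + (j + 1) - 1 = Suc n" "i + (j + 1) = n + 2"
      "2 * int i - int (j + 1) = 2 * int i - 1 - int j"
      "2 * int (j + 1) - int i = 2 * int j + 2 - int i"
      using n by simp_all
    then show ?thesis
      unfolding u_coeff_def c_def n(2) by (simp only: X3 Y_def[symmetric]) (simp add: y_def power_add mult_ac add_ac)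
  qed
  have e: "u_coeff (i + 1) j = 16 * y * (x + y) * (2 * y - x) * (2 * y + 1 - x) * (2 * y + 2 - x) * c"
  proof -
    have "i + 1 + j - 1 = Suc n" "i + 1 + j = n + 2"
      "2 * int (i + 1) - int j = 2 * int i + 2 - int j"
      "2 * int j - int (i + 1) = 2 * int j - 1 - int i"
      using n by simp_all
    then show ?thesis
      unfolding u_coeff_def c_def n(2) by (simp only: Y3 X_def[symmetric]) (simp add: y_def power_add mult_ac add_ac)
  qed
  show ?thesis
    unfolding a b d e by algebra
qed

lemma u_coeff_column_1: "u_coeff i 1 = (if i = 1 then 24 else if i = 2 then 32 else (0 :: 'a::field_char_0))"
proof -
  consider "i = 0" | "i = 1" | "i = 2" | "i > 2" by linarith
  then show ?thesis
    by cases (simp_all add: u_coeff_eq_0, simp_all add: u_coeff_def inv_fact_def fact_numeral eval_nat_numeral)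
qed

lemma u_coeff_column_2: "u_coeff i 2 = (if i = 1 then 64 else if i = 2 then 1152 else if i = 3 then 3072
    else if i = 4 then 2048 else (0 :: 'a::field_char_0))"
proof -
  consider "i = 0" | "i = 1" | "i = 2" | "i = 3" | "i = 4" | "i > 4" by linarith
  then show ?thesis
    by cases (simp_all add: u_coeff_eq_0, simp_all add: u_coeff_def inv_fact_def fact_numeral)
qed

lemma hecke_U_form_g_power:
  assumes "j \<ge> 1"
  shows "hecke_U (form_g ^ j) = (Abs_fps (\<lambda>i. u_coeff i j) oo form_g :: 'a::field_char_0 fps)"
  using assms
proof (induction j rule: less_induct)
  case (less j)
  have c0: "fps_nth form_g 0 = (0 :: 'a)" by (rule form_g_nth)
  \<comment> \<open>Column 2 is a base case because its recurrence involves U 1, which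
    \<open>u_coeff\<close> does not describe.\<close>
  consider "j = 1" | "j = 2" | k where "j = k + 2" "k \<ge> 1"
    using less.prems by atomize_elim presburger
  then show ?case
  proof cases
    case 1
    have "Abs_fps (\<lambda>i. u_coeff i 1) = (24 * fps_X + 32 * fps_X\<^sup>2 :: 'a fps)"
      by (rule fps_ext) (simp add: u_coeff_column_1[unfolded One_nat_def] fps_numeral_fps_const fps_X_power_iff)
    then show ?thesis
      unfolding 1 by (simp add: hecke_U_form_g fps_compose_add_distrib fps_compose_mult_distrib
        fps_X_power_compose c0)
  next
    case 2
    have eq: "Abs_fps (\<lambda>i. u_coeff i 2) = (64 * fps_X + 1152 * fps_X\<^sup>2 + 3072 * fps_X ^ 3 + 2048 * fps_X ^ 4 :: 'a fps)"
      by (rule fps_ext) (simp add: u_coeff_column_2 fps_numeral_fps_const fps_X_power_iff)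
    have "hecke_U (form_g ^ 2) = (48 * form_g + 64 * form_g\<^sup>2) * (24 * form_g + 32 * form_g\<^sup>2) + 64 * (form_g :: 'a fps)"
      using hecke_U_form_g_power_rec[of 0, where ?'a='a] by (simp only: add_0 power_0 power_one_right hecke_U_form_g hecke_U_1 mult_1_right)
    also have "\<dots> = 64 * form_g + 1152 * form_g\<^sup>2 + 3072 * form_g ^ 3 + 2048 * form_g ^ 4"
      by algebra
    finally show ?thesis
      unfolding 2 eq by (simp add: fps_compose_add_distrib fps_compose_mult_distrib
        fps_X_power_compose c0)
  next
    case (3 k)
    have eq: "Abs_fps (\<lambda>i. u_coeff i (k + 2)) = (48 * fps_X + 64 * fps_X\<^sup>2) * Abs_fps (\<lambda>i. u_coeff i (k + 1)) +
        64 * fps_X * (Abs_fps (\<lambda>i. u_coeff i k) :: 'a fps)"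
    proof (rule fps_ext)
      fix i
      have const: "fps_nth (48 * F) n = 48 * fps_nth F n" "fps_nth (64 * F) n = 64 * fps_nth F n" for F :: "'a fps" and n
        by (simp_all add: fps_numeral_fps_const)
      consider "i = 0" | "i = 1" | m :: nat where "i = m + 2"
        by atomize_elim presburger
      then show "fps_nth (Abs_fps (\<lambda>i. u_coeff i (k + 2))) i = fps_nth ((48 * fps_X + 64 * fps_X\<^sup>2) * Abs_fps (\<lambda>i. u_coeff i (k + 1)) +
        64 * fps_X * (Abs_fps (\<lambda>i. u_coeff i k) :: 'a fps)) i"
        using \<open>k \<ge> 1\<close>
        by cases (simp_all add: distrib_right mult.assoc const u_coeff_eq_0 fps_X_power_mult_nth
          u_coeff_rec[simplified])
    qed
    show ?thesis
      unfolding \<open>j = k + 2\<close> hecke_U_form_g_power_rec eq using less.IH[of k] less.IH[of "k + 1"] 3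
      by (simp add: fps_compose_add_distrib fps_compose_mult_distrib fps_X_power_compose c0)
  qed
qed

text \<open>Row i of the matrix is supported on j \<le> 2i, so U acts on the coordinates by finite
  sums and no limit is taken.\<close>

lemma hecke_U_compose_form_g:
  fixes a :: "nat \<Rightarrow> 'a::field_char_0"
  assumes "a 0 = 0"
  shows "hecke_U (Abs_fps a oo form_g) = Abs_fps (\<lambda>i. \<Sum>j=1..2*i. u_coeff i j * a j) oo form_g"
proof (rule fps_ext)
  fix m
  have "fps_nth (hecke_U (Abs_fps a oo form_g)) m = (\<Sum>j=0..2*m. a j * fps_nth (hecke_U (form_g ^ j)) m)"
    by (simp add: hecke_U_def fps_compose_nth)
  also have "\<dots> = (\<Sum>j=1..2*m. a j * fps_nth (hecke_U (form_g ^ j)) m)"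
    using assms by (intro sum.mono_neutral_right) (auto simp: Suc_le_eq)
  also have "\<dots> = (\<Sum>j=1..2*m. \<Sum>i=0..m. a j * (u_coeff i j * fps_nth (form_g ^ i) m))"
    by (intro sum.cong refl) (simp add: hecke_U_form_g_power fps_compose_nth sum_distrib_left)
  also have "\<dots> = (\<Sum>i=0..m. \<Sum>j=1..2*m. a j * (u_coeff i j * fps_nth (form_g ^ i) m))"
    by (rule sum.swap)
  also have "\<dots> = (\<Sum>i=0..m. \<Sum>j=1..2*i. a j * (u_coeff i j * fps_nth (form_g ^ i) m))"
    by (intro sum.cong refl sum.mono_neutral_right) (auto simp: u_coeff_eq_0)
  also have "\<dots> = fps_nth (Abs_fps (\<lambda>i. \<Sum>j=1..2*i. u_coeff i j * a j) oo form_g) m"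
    by (simp add: fps_compose_nth sum_distrib_left sum_distrib_right mult_ac)
  finally show "fps_nth (hecke_U (Abs_fps a oo form_g)) m =
      fps_nth (Abs_fps (\<lambda>i. \<Sum>j=1..2*i. u_coeff i j * a j) oo form_g) m" .
qed

section \<open>Factorization of the matrix\<close>

text \<open>The k-th summand of the (i, j) entry of A D B, stripped of the factor depending on i and
  j alone.\<close>

definition ldu_term :: "nat \<Rightarrow> nat \<Rightarrow> nat \<Rightarrow> 'a::field_char_0"
  where "ldu_term i j k = 4 * of_nat k * fact (2 * k + i - 1) * fact (2 * k + j - 1) /
    (fact (i + k) * fact (j + k)) *
    inv_fact (2 * int k - int i) * inv_fact (2 * int k - int j) * inv_fact (int i - int k) * inv_fact (int j - int k)"

definition ldu_cert :: "nat \<Rightarrow> nat \<Rightarrow> nat \<Rightarrow> 'a::field_char_0"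
  where "ldu_cert i j k = fact (2 * k + i - 1) * fact (2 * k + j - 1) / (fact (i + k) * fact (j + k - 1)) *
    inv_fact (2 * int k - int i - 2) * inv_fact (2 * int k - int j - 2) *
    inv_fact (int i + 1 - int k) * inv_fact (int j - int k)"

text \<open>The certificate was found with Gosper's algorithm.\<close>

lemma ldu_term_telescope:
  fixes i j k :: nat
  assumes "i \<ge> 1" "j \<ge> 1" "k \<ge> 1"
  shows "of_nat (i + j + 1) *
      (of_int (2 * int i + 2 - int j) * of_int (2 * int i + 1 - int j) * of_nat (i + 1) * ldu_term (i + 1) j k
        - 2 * of_nat (2 * i + 1) * of_nat (i + j) * of_int (2 * int j - int i) * ldu_term i j k)
    = - 2 * of_nat (3 * i + 2) * (ldu_cert i j (k + 1) - ldu_cert i j k :: 'a::field_char_0)"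
proof -
  define x y z :: 'a where "x = of_nat i" and "y = of_nat j" and "z = of_nat k"
  note xyz = x_def y_def z_def
  define W X Y Z :: 'a where "W = inv_fact (2 * int k - int i)" and "X = inv_fact (2 * int k - int j)"
    and "Y = inv_fact (int i + 1 - int k)" and "Z = inv_fact (int j - int k)"
  define p q r s :: 'a where "p = fact (2 * k + i - 1)" and "q = fact (2 * k + j - 1)"
    and "r = fact (i + k)" and "s = fact (j + k - 1)"
  define v w where "v = x + z + 1" and "w = y + z"
  \<comment> \<open>A common factor: both terms and both certificates are polynomial multiples of
    \<open>t\<close>, which leaves a polynomial identity in x, y, z.\<close>
  define t where "t = p * q * W * X * Y * Z / (r * s * v * w)"
  have nz: "r \<noteq> 0" "s \<noteq> 0" "v \<noteq> 0" "w \<noteq> 0"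
    using assms unfolding r_def s_def v_def w_def xyz
    by (simp_all flip: of_nat_add of_nat_Suc add: add.commute)
  have facts: "fact (i + 1 + k) = v * r" "fact (j + k) = w * s"
    "fact (2 * k + (i + 1) - 1) = (2 * z + x) * p"
    "fact (2 * (k + 1) + i - 1) = (2 * z + x + 1) * (2 * z + x) * p"
    "fact (2 * (k + 1) + j - 1) = (2 * z + y + 1) * (2 * z + y) * q"
  proof -
    have 1: "fact (j + k) = (of_nat (j + k) * fact (j + k - 1) :: 'a)"
      using assms by (intro fact_reduce) simp
    have 2: "fact (2 * k + i) = (of_nat (2 * k + i) * fact (2 * k + i - 1) :: 'a)"
      using assms by (intro fact_reduce) simp
    have 3: "fact (2 * k + j) = (of_nat (2 * k + j) * fact (2 * k + j - 1) :: 'a)"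
      using assms by (intro fact_reduce) simp
    have 4: "2 * (k + 1) + i - 1 = Suc (2 * k + i)" "2 * (k + 1) + j - 1 = Suc (2 * k + j)"
      "2 * k + (i + 1) - 1 = 2 * k + i" "i + 1 + k = Suc (i + k)" by simp_all
    show "fact (i + 1 + k) = v * r" "fact (j + k) = w * s"
      "fact (2 * k + (i + 1) - 1) = (2 * z + x) * p"
      "fact (2 * (k + 1) + i - 1) = (2 * z + x + 1) * (2 * z + x) * p"
      "fact (2 * (k + 1) + j - 1) = (2 * z + y + 1) * (2 * z + y) * q"
      unfolding 4 fact_Suc 1 2 3 p_def q_def r_def s_def v_def w_def xyz by simp_all
  qed
  have shift: "2 * int (k + 1) - int i - 2 = 2 * int k - int i" "2 * int (k + 1) - int j - 2 = 2 * int k - int j"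
    "int (i + 1) - int k = int i + 1 - int k" "int i + 1 - int (k + 1) = int i - int k"
    "2 * int k - int (i + 1) = 2 * int k - int i - 1" "int j - int (k + 1) = int j - int k - 1"
    by simp_all
  have W1: "inv_fact (2 * int k - int i - 1) = (2 * z - x) * W"
    unfolding W_def by (subst inv_fact_pred[of _ "2 * int k - int i"]) (simp_all add: xyz)
  have W2: "inv_fact (2 * int k - int i - 2) = (2 * z - x - 1) * ((2 * z - x) * W)"
    unfolding W1[symmetric] by (subst inv_fact_pred[of _ "2 * int k - int i - 1"]) (simp_all add: xyz)
  have X1: "inv_fact (2 * int k - int j - 1) = (2 * z - y) * X"
    unfolding X_def by (subst inv_fact_pred[of _ "2 * int k - int j"]) (simp_all add: xyz)
  have X2: "inv_fact (2 * int k - int j - 2) = (2 * z - y - 1) * ((2 * z - y) * X)"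
    unfolding X1[symmetric] by (subst inv_fact_pred[of _ "2 * int k - int j - 1"]) (simp_all add: xyz)
  have Y1: "inv_fact (int i - int k) = (x + 1 - z) * Y"
    unfolding Y_def by (subst inv_fact_pred[of _ "int i + 1 - int k"]) (simp_all add: xyz)
  have Z1: "inv_fact (int j - int k - 1) = (y - z) * Z"
    unfolding Z_def by (subst inv_fact_pred[of _ "int j - int k"]) (simp_all add: xyz)
  note invs = shift W1 W2 X1 X2 Y1 Z1
  have T: "ldu_term i j k = 4 * z * (x + 1 - z) * v * t"
    unfolding ldu_term_def facts invs W_def[symmetric] X_def[symmetric] Z_def[symmetric]
      p_def[symmetric] q_def[symmetric] r_def[symmetric] z_def[symmetric] t_def
    using nz by (simp add: field_simps)
  have T': "ldu_term (i + 1) j k = 4 * z * (2 * z + x) * (2 * z - x) * t"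
    unfolding ldu_term_def facts invs W_def[symmetric] X_def[symmetric] Z_def[symmetric] Y_def[symmetric]
      p_def[symmetric] q_def[symmetric] r_def[symmetric] z_def[symmetric] t_def
    using nz by (simp add: field_simps)
  have G: "ldu_cert i j k = (2 * z - x) * (2 * z - x - 1) * (2 * z - y) * (2 * z - y - 1) * v * w * t"
    unfolding ldu_cert_def facts invs W_def[symmetric] X_def[symmetric] Z_def[symmetric] Y_def[symmetric]
      p_def[symmetric] q_def[symmetric] r_def[symmetric] s_def[symmetric] z_def[symmetric] t_def
    using nz by (simp add: divide_simps)
  have sh2: "i + (k + 1) = i + 1 + k" "j + (k + 1) - 1 = j + k" by simp_all
  have G': "ldu_cert i j (k + 1) = (2 * z + x + 1) * (2 * z + x) * (2 * z + y + 1) * (2 * z + y) * (x + 1 - z) * (y - z) * t"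
    unfolding ldu_cert_def sh2 facts invs W_def[symmetric] X_def[symmetric] Z_def[symmetric]
      z_def[symmetric] t_def
    using nz by (simp add: divide_simps)
  have coeffs: "of_nat (i + j + 1) = x + y + 1" "of_int (2 * int i + 2 - int j) = 2 * x + 2 - y"
    "of_int (2 * int i + 1 - int j) = 2 * x + 1 - y" "of_nat (i + 1) = x + 1"
    "of_nat (2 * i + 1) = 2 * x + 1" "of_nat (i + j) = x + y" "of_int (2 * int j - int i) = 2 * y - x"
    "of_nat (3 * i + 2) = 3 * x + 2"
    by (simp_all add: xyz)
  show ?thesis
    unfolding coeffs T T' G G' v_def w_def by algebra
qed

definition ldu_sum :: "nat \<Rightarrow> nat \<Rightarrow> 'a::field_char_0"
  where "ldu_sum i j = fact (2 * i) * fact (2 * j) * fact (i + j - 1) / (fact i ^ 2 * fact j ^ 2) *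
    inv_fact (2 * int i - int j) * inv_fact (2 * int j - int i)"

text \<open>Zeilberger's method: summing the telescoping relation over k leaves only boundary
  certificates. These vanish, at k = 1 through 1/(2k-i-2)! and at k = j + 1 through
  1/(j-k)!.\<close>

lemma sum_ldu_term_rec:
  fixes i j :: nat
  assumes "i \<ge> 1" "j \<ge> 1"
  shows "of_int (2 * int i + 2 - int j) * of_int (2 * int i + 1 - int j) * of_nat (i + 1) * (\<Sum>k=1..j. ldu_term (i + 1) j k)
    = 2 * of_nat (2 * i + 1) * of_nat (i + j) * of_int (2 * int j - int i) * (\<Sum>k=1..j. ldu_term i j k :: 'a::field_char_0)"
    (is "?a * _ = ?b * _")
proof -
  have "of_nat (i + j + 1) * (?a * (\<Sum>k=1..j. ldu_term (i + 1) j k) - ?b * (\<Sum>k=1..j. ldu_term i j k)) =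
      (\<Sum>k=1..j. of_nat (i + j + 1) * (?a * ldu_term (i + 1) j k - ?b * ldu_term i j k))"
    by (simp add: sum_distrib_left sum_subtractf right_diff_distrib)
  also have "\<dots> = (\<Sum>k=1..j. - 2 * of_nat (3 * i + 2) * (ldu_cert i j (k + 1) - ldu_cert i j k))"
    using assms by (intro sum.cong refl ldu_term_telescope) auto
  also have "\<dots> = - 2 * of_nat (3 * i + 2) * (\<Sum>k=1..j. ldu_cert i j (Suc k) - ldu_cert i j k)"
    by (simp add: sum_distrib_left)
  also have "(\<Sum>k=1..j. ldu_cert i j (Suc k) - ldu_cert i j k) = (ldu_cert i j (Suc j) - ldu_cert i j 1 :: 'a)"
    using assms by (intro sum_Suc_diff) auto
  also have "\<dots> = 0"
    using assms by (simp add: ldu_cert_def)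
  finally show ?thesis
    by (simp del: of_nat_Suc of_nat_add add: of_nat_neq_0)
qed

lemma ldu_sum_rec:
  fixes i j :: nat
  assumes "i \<ge> 1" "j \<ge> 1"
  shows "of_int (2 * int i + 2 - int j) * of_int (2 * int i + 1 - int j) * of_nat (i + 1) * ldu_sum (i + 1) j
    = 2 * of_nat (2 * i + 1) * of_nat (i + j) * of_int (2 * int j - int i) * (ldu_sum i j :: 'a::field_char_0)"
proof -
  define x y :: 'a where "x = of_nat i" and "y = of_nat j"
  define X Y :: 'a where "X = inv_fact (2 * int i + 2 - int j)" and "Y = inv_fact (2 * int j - int i)"
  define p q r s :: 'a where "p = fact (2 * i)" and "q = fact (2 * j)" and "r = fact i" and "s = fact (i + j - 1)"
  have nz: "x + 1 \<noteq> 0" "r \<noteq> 0" "(fact j :: 'a) \<noteq> 0"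
    unfolding x_def r_def by (simp_all flip: of_nat_Suc add: add.commute)
  have X1: "inv_fact (2 * int i + 1 - int j) = (2 * x + 2 - y) * X"
    unfolding X_def by (subst inv_fact_pred[of _ "2 * int i + 2 - int j"]) (simp_all add: x_def y_def)
  have X2: "inv_fact (2 * int i - int j) = (2 * x + 1 - y) * ((2 * x + 2 - y) * X)"
    unfolding X1[symmetric] by (subst inv_fact_pred[of _ "2 * int i + 1 - int j"]) (simp_all add: x_def y_def)
  have Y1: "inv_fact (2 * int j - int i - 1) = (2 * y - x) * Y"
    unfolding Y_def by (subst inv_fact_pred[of _ "2 * int j - int i"]) (simp_all add: x_def y_def)
  have shift: "2 * int (i + 1) - int j = 2 * int i + 2 - int j" "2 * int j - int (i + 1) = 2 * int j - int i - 1"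
    by simp_all
  have facts: "fact (2 * (i + 1)) = (2 * x + 2) * (2 * x + 1) * p" "fact (i + 1 + j - 1) = (x + y) * s"
    "fact (i + 1) = (x + 1) * r"
  proof -
    have "2 * (i + 1) = Suc (Suc (2 * i))" by simp
    then show "fact (2 * (i + 1)) = (2 * x + 2) * (2 * x + 1) * p"
      by (simp add: x_def p_def algebra_simps)
    have "fact (i + j) = (of_nat (i + j) * fact (i + j - 1) :: 'a)"
      using assms by (intro fact_reduce) simp
    then show "fact (i + 1 + j - 1) = (x + y) * s"
      by (simp add: x_def y_def s_def)
    show "fact (i + 1) = (x + 1) * r"
      by (simp add: x_def r_def)
  qed
  have coeffs: "of_int (2 * int i + 2 - int j) = 2 * x + 2 - y"
    "of_int (2 * int i + 1 - int j) = 2 * x + 1 - y" "of_nat (i + 1) = x + 1"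
    "of_nat (2 * i + 1) = 2 * x + 1" "of_nat (i + j) = x + y" "of_int (2 * int j - int i) = 2 * y - x"
    by (simp_all add: x_def y_def)
  show ?thesis
    unfolding coeffs ldu_sum_def shift X2 Y1 facts
    unfolding X_def[symmetric] Y_def[symmetric] p_def[symmetric] q_def[symmetric] r_def[symmetric] s_def[symmetric]
    using nz by (simp add: divide_simps) algebra
qed

text \<open>Sum and closed form share a first order recurrence in i, run downwards from i = 2j,
  where only k = j contributes. In this direction the divisor contains 2j - i, nonzero for i < 2j;
  upwards it would vanish at 2i + 1 = j or 2i + 2 = j. For i > 2j both sides are 0.\<close>

lemma sum_ldu_term:
  assumes "i \<ge> 1" "j \<ge> 1"
  shows "(\<Sum>k=1..j. ldu_term i j k) = (ldu_sum i j :: 'a::field_char_0)"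
proof (cases "i \<le> 2 * j")
  case False
  then show ?thesis by (simp add: ldu_sum_def ldu_term_def)
next
  case True
  then show ?thesis using assms(1)
  proof (induction i rule: inc_induct)
    case base
    have "(\<Sum>k=1..j. ldu_term (2 * j) j k :: 'a) = (\<Sum>k\<in>{j}. ldu_term (2 * j) j k)"
      using assms by (intro sum.mono_neutral_right) (auto simp: ldu_term_def)
    also have "\<dots> = ldu_sum (2 * j) j"
    proof -
      have f: "fact (4 * j) = (4 * of_nat j * fact (4 * j - 1) :: 'a)"
        "fact (3 * j) = (3 * of_nat j * fact (3 * j - 1) :: 'a)"
        using assms by (subst fact_reduce; simp)+
      have a: "2 * j + 2 * j - 1 = 4 * j - 1" "2 * j + j - 1 = 3 * j - 1" "2 * j + j = 3 * j" "2 * (2 * j) = 4 * j"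
        "2 * int j - int (2 * j) = int 0" "2 * int (2 * j) - int j = int (3 * j)"
        "2 * int j - int j = int j" "int (2 * j) - int j = int j" "int j - int j = int 0" "j + j = 2 * j" by simp_all
      show ?thesis
        unfolding ldu_sum_def sum.insert_remove[OF finite.emptyI] ldu_term_def
        using assms by (simp only: sum.empty Diff_empty a inv_fact_of_nat f) (simp add: a f divide_simps power2_eq_square)
    qed
    finally show ?case .
  next
    case (step i)
    have "2 * of_nat (2 * i + 1) * of_nat (i + j) * of_int (2 * int j - int i) \<noteq> (0 :: 'a)"
      using step.hyps assms by (simp del: of_nat_Suc of_nat_add of_int_diff of_int_mult of_nat_mult)
    moreover have "(\<Sum>k=1..j. ldu_term (i + 1) j k) = (ldu_sum (i + 1) j :: 'a)"
      using step by simp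
    ultimately show ?case
      using sum_ldu_term_rec[of i j, where ?'a='a] ldu_sum_rec[of i j, where ?'a='a] step.prems assms by simp
  qed
qed

text \<open>The matrix A, supported on k \<le> i \<le> 2k. As \<open>u_coeff i j\<close> divided by
  j is symmetric in i and j, B needs no formula of its own: it is the transpose of A conjugated by
  the diagonal matrix of indices, with entries A_jk j / k.\<close>

definition lower_coeff :: "nat \<Rightarrow> nat \<Rightarrow> 'a::field_char_0"
  where "lower_coeff i k = 4 ^ i * fact i ^ 2 * fact (2 * k) ^ 2 * fact (2 * k + i - 1) /
    (4 ^ k * fact k * fact (3 * k - 1) * fact (2 * i) * fact (i + k)) *
    inv_fact (2 * int k - int i) * inv_fact (int i - int k)"

text \<open>Since (2k)! is 2^k k! times an odd number, the 2-adic valuation is 1 + 2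
  v((3k)!/k!).\<close>

definition diag_coeff :: "nat \<Rightarrow> 'a::field_char_0"
  where "diag_coeff k = 2 ^ (4 * k + 1) * fact (3 * k) ^ 2 * fact k ^ 2 / (3 * fact (2 * k) ^ 4)"

lemma u_coeff_factorization:
  assumes "i \<ge> 1" "j \<ge> 1"
  shows "u_coeff i j = (\<Sum>k=1..j. lower_coeff i k * (diag_coeff k * (lower_coeff j k * of_nat j / of_nat k)) :: 'a::field_char_0)"
proof -
  \<comment> \<open>The part of each summand that does not depend on k.\<close>
  define c :: 'a where "c = 3 / 2 * of_nat j * 4 ^ (i + j) * fact i ^ 2 * fact j ^ 2 / (fact (2 * i) * fact (2 * j))"
  have "lower_coeff i k * (diag_coeff k * (lower_coeff j k * of_nat j / of_nat k)) = c * ldu_term i j k"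
    if "k \<in> {1..j}" for k
  proof -
    have f: "fact (3 * k) = (3 * of_nat k * fact (3 * k - 1) :: 'a)"
      using that by (subst fact_reduce) auto
    have p: "(2 :: 'a) ^ (4 * k) = 4 ^ k * 4 ^ k"
      by (simp add: power_mult flip: power_mult_distrib)
    have nz: "of_nat k \<noteq> (0 :: 'a)" "4 ^ k \<noteq> (0 :: 'a)" using that by simp_all
    show ?thesis
      unfolding lower_coeff_def diag_coeff_def f c_def ldu_term_def power_add p
      using nz by (simp add: divide_simps power2_eq_square power4_eq_xxxx)
  qed
  then have "(\<Sum>k=1..j. lower_coeff i k * (diag_coeff k * (lower_coeff j k * of_nat j / of_nat k))) = c * ldu_sum i j"
    using sum_ldu_term[OF assms, where ?'a='a] by (simp flip: sum_distrib_left)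
  also have "\<dots> = u_coeff i j"
    unfolding c_def ldu_sum_def u_coeff_def by (simp add: divide_simps)
  finally show ?thesis ..
qed

section \<open>Absolute values and rationality\<close>

lemma absval_0 [simp]: "absval 0 = 0"
  by (simp add: absval_eq_0_iff)

lemma absval_nonneg [simp]: "absval x \<ge> 0"
  using dist_absval[of x 0] zero_le_dist[of x 0] by simp

lemma absval_1 [simp]: "absval 1 = 1"
  using absval_mult[of 1 1] absval_eq_0_iff[of 1] by auto

lemma absval_minus [simp]: "absval (- x) = absval x"
  using dist_absval[of 0 x] dist_absval[of x 0] by (simp add: dist_commute)

lemma absval_minus_commute: "absval (x - y) = absval (y - x)"
  by (metis absval_minus minus_diff_eq)

lemma absval_power: "absval (x ^ n) = absval x ^ n"
  by (induction n) (simp_all add: absval_mult)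

lemma absval_divide: "absval (x / y) = absval x / absval y"
proof (cases "y = 0")
  case False
  then have "absval x = absval (x / y) * absval y"
    by (simp flip: absval_mult)
  then show ?thesis using False by (simp add: absval_eq_0_iff)
qed simp

lemma absval_add_le: "absval x \<le> B \<Longrightarrow> absval y \<le> B \<Longrightarrow> absval (x + y) \<le> B"
  using absval_add_le_max[of x y] by simp

lemma absval_diff_le: "absval x \<le> B \<Longrightarrow> absval y \<le> B \<Longrightarrow> absval (x - y) \<le> B"
  using absval_add_le[of x B "- y"] by simp

lemma absval_sum_le:
  assumes "\<And>i. i \<in> A \<Longrightarrow> absval (f i) \<le> B" "B \<ge> 0"
  shows "absval (sum f A) \<le> B"
  using assms by (induction A rule: infinite_finite_induct) (auto intro: absval_add_le)

lemma absval_mult_le: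
  assumes "absval x \<le> A" "absval y \<le> B"
  shows "absval (x * y) \<le> A * B"
  unfolding absval_mult using assms by (intro mult_mono) (auto intro: order_trans[OF absval_nonneg])

lemma absval_prod: "absval (prod f A) = (\<Prod>i\<in>A. absval (f i))"
  by (induction A rule: infinite_finite_induct) (simp_all add: absval_mult)

text \<open>A quantitative form of membership in \<open>Q2\<close>. Sums keep the radius s, by the
  ultrametric inequality, while a rational factor of absolute value at most 1/2 halves it.\<close>

definition near_rat :: "real \<Rightarrow> 'a::nonarch_valued_field \<Rightarrow> bool"
  where "near_rat s x \<longleftrightarrow> (\<exists>q\<in>\<rat>. absval (x - q) \<le> s)"

lemma near_rat_mono: "near_rat s x \<Longrightarrow> s \<le> t \<Longrightarrow> near_rat t x"
  unfolding near_rat_def by (meson order_trans)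

lemma near_rat_Rats: "x \<in> \<rat> \<Longrightarrow> s \<ge> 0 \<Longrightarrow> near_rat s x"
  unfolding near_rat_def by (intro bexI[of _ x]) auto

lemma near_rat_add: "near_rat s x \<Longrightarrow> near_rat s y \<Longrightarrow> near_rat s (x + y)"
  unfolding near_rat_def
proof safe
  fix p q :: 'a assume "p \<in> \<rat>" "absval (x - p) \<le> s" "q \<in> \<rat>" "absval (y - q) \<le> s"
  then show "\<exists>q\<in>\<rat>. absval (x + y - q) \<le> s"
    using absval_add_le[of "x - p" s "y - q"]
    by (intro bexI[of _ "p + q"]) (auto simp: algebra_simps)
qed

lemma near_rat_mult_Rats:
  assumes "near_rat s x" "r \<in> \<rat>" "absval r \<le> c"
  shows "near_rat (c * s) (r * x)"
proof -
  obtain q where q: "q \<in> \<rat>" "absval (x - q) \<le> s"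
    using assms by (auto simp: near_rat_def)
  have "absval (r * (x - q)) \<le> c * s"
    using assms q by (intro absval_mult_le)
  then show ?thesis
    unfolding near_rat_def using assms q by (intro bexI[of _ "r * q"]) (auto simp: algebra_simps)
qed

lemma near_rat_diff:
  assumes "near_rat s x" "near_rat s y"
  shows "near_rat s (x - y)"
  using near_rat_add[OF assms(1), of "- y"] near_rat_mult_Rats[OF assms(2), of "-1" 1] by simp

lemma near_rat_sum:
  assumes "\<And>i. i \<in> A \<Longrightarrow> near_rat s (f i)" "s \<ge> 0"
  shows "near_rat s (sum f A)"
  using assms by (induction A rule: infinite_finite_induct) (auto intro: near_rat_add near_rat_Rats)

lemma near_rat_mult:
  assumes "near_rat s x" "near_rat s y" "absval x \<le> 1" "absval y \<le> 1" "s \<le> 1"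
  shows "near_rat s (x * y)"
proof -
  obtain p q where pq: "p \<in> \<rat>" "absval (x - p) \<le> s" "q \<in> \<rat>" "absval (y - q) \<le> s"
    using assms by (auto simp: near_rat_def)
  \<comment> \<open>Here \<open>s \<le> 1\<close> enters: it keeps the approximant in the unit
    ball.\<close>
  have "absval q \<le> 1"
    using absval_diff_le[of y 1 "y - q"] assms pq by simp
  then have "absval (x * (y - q) + q * (x - p)) \<le> s"
    using assms pq absval_mult_le[of x 1 "y - q" s] absval_mult_le[of q 1 "x - p" s]
    by (intro absval_add_le) simp_all
  then show ?thesis
    unfolding near_rat_def using pq by (intro bexI[of _ "p * q"]) (auto simp: algebra_simps)
qed

lemma Q2_iff: "x \<in> Q2 \<longleftrightarrow> (\<forall>s>0. near_rat s x)"
proof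
  assume "x \<in> Q2"
  then show "\<forall>s>0. near_rat s x"
    unfolding Q2_def closure_approachable near_rat_def
    by (metis dist_absval dist_commute less_imp_le)
next
  assume *: "\<forall>s>0. near_rat s x"
  show "x \<in> Q2"
    unfolding Q2_def closure_approachable
  proof safe
    fix e :: real assume "e > 0"
    then have "near_rat (e / 2) x" using * by simp
    then obtain q where "q \<in> \<rat>" "absval (x - q) \<le> e / 2" by (auto simp: near_rat_def)
    then show "\<exists>y\<in>\<rat>. dist y x < e"
      using \<open>e > 0\<close> by (intro bexI[of _ q]) (auto simp: dist_absval absval_minus_commute[of q])
  qed
qed

lemma Q2_Rats: "x \<in> \<rat> \<Longrightarrow> x \<in> Q2"
  by (simp add: Q2_iff near_rat_Rats)

lemma Q2_sum: "(\<And>i. i \<in> A \<Longrightarrow> f i \<in> Q2) \<Longrightarrow> sum f A \<in> Q2"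
  by (simp add: Q2_iff near_rat_sum)

lemma Q2_mult:
  assumes "x \<in> Q2" "y \<in> Q2"
  shows "x * y \<in> Q2"
  unfolding Q2_iff
proof safe
  fix s :: real assume s: "s > 0"
  define c where "c = 1 + absval x + absval y"
  have c: "c > 0" "absval x \<le> c" "absval y \<le> c"
    by (simp_all add: c_def add_pos_nonneg add_nonneg_nonneg)
  define e where "e = min c (s / c)"
  have e: "e > 0" "e \<le> c" "c * e \<le> s"
    using s c by (simp_all add: e_def min_def field_simps)
  obtain p q where pq: "p \<in> \<rat>" "absval (x - p) \<le> e" "q \<in> \<rat>" "absval (y - q) \<le> e"
    using assms e(1) unfolding Q2_iff near_rat_def by metis
  have "absval q \<le> c"
    using absval_diff_le[of y c "y - q"] c e pq by simp
  then have "absval (x * (y - q) + q * (x - p)) \<le> c * e"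
    using c pq by (intro absval_add_le absval_mult_le)
  then show "near_rat s (x * y)"
    unfolding near_rat_def using pq e by (intro bexI[of _ "p * q"]) (auto simp: algebra_simps)
qed

lemma Q2_inverse:
  assumes "x \<in> Q2"
  shows "inverse x \<in> Q2"
proof (cases "x = 0")
  case False
  then have x: "absval x > 0"
    using absval_nonneg[of x] absval_eq_0_iff[of x] by linarith
  show ?thesis
    unfolding Q2_iff
  proof safe
    fix s :: real assume s: "s > 0"
    define e where "e = min (absval x / 2) (s * absval x * absval x)"
    have e: "e > 0" "e < absval x" "e \<le> s * absval x * absval x"
      using s x by (auto simp: e_def min_def)
    obtain q where q: "q \<in> \<rat>" "absval (x - q) \<le> e"
      using assms e(1) unfolding Q2_iff near_rat_def by metis
    \<comment> \<open>An approximation error smaller than |x| cannot make q smaller than x.\<close>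
    have xq: "absval x \<le> absval q"
      using absval_add_le_max[of "x - q" q] q e by simp
    then have "q \<noteq> 0" using x by auto
    then have "inverse x - inverse q = (q - x) / (x * q)"
      using False by (simp add: field_simps)
    also have "absval \<dots> = absval (x - q) / (absval x * absval q)"
      using absval_minus[of "x - q"] by (simp add: absval_divide absval_mult)
    also have "\<dots> \<le> (s * absval x * absval x) / (absval x * absval x)"
      using q e xq x s by (intro frac_le mult_left_mono) auto
    also have "\<dots> = s"
      using x by simp
    finally show "near_rat s (inverse x)"
      unfolding near_rat_def using q by (intro bexI[of _ "inverse q"]) auto
  qed
qed (simp add: Q2_Rats)

text \<open>If all coordinates are within distance \<open>s\<close> of the rationals, then the equation puts them
  within distance \<open>s / 2\<close>: the parameter \<open>l\<close> is eliminated through the coordinate \<open>m\<close>.\<close>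

lemma eigenvector_coords_in_Q2:
  fixes z d :: "nat \<Rightarrow> 'a::nonarch_valued_field"
  assumes d: "\<And>k. d k \<in> \<rat>" "\<And>k. d k \<noteq> 0" "\<And>k n. k < n \<Longrightarrow> absval (d n / d k) \<le> 1 / 4"
    and E: "\<And>k n. k \<in> I \<Longrightarrow> n \<in> J k \<Longrightarrow> E k n \<in> \<rat> \<and> absval (E k n) \<le> 1 / 2 \<and> n \<in> I"
    and eq: "\<And>k. k \<in> I \<Longrightarrow> l * z k = d k * (z k + (\<Sum>n\<in>J k. E k n * z n))"
    and z: "\<And>k. k \<in> I \<Longrightarrow> absval (z k) \<le> 1"
    and m: "m \<in> I" "z m = 1"
    and "k \<in> I"
  shows "z k \<in> Q2"
proof -
  define w where "w k = (\<Sum>n\<in>J k. E k n * z n)" for k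
  have w: "absval (w k) \<le> 1 / 2" if "k \<in> I" for k
    unfolding w_def using E[OF that] z absval_mult_le[of "E k n" "1/2" "z n" 1 for n]
    by (intro absval_sum_le) force+
  have l: "l = d m * (1 + w m)"
    using eq[OF m(1)] m(2) by (simp add: w_def)
  have "\<forall>k\<in>I. near_rat ((1 / 2) ^ n) (z k)" for n
  proof (induction n)
    case 0
    show ?case
      unfolding near_rat_def using z by (auto intro!: bexI[of _ 0])
  next
    case (Suc n)
    define s :: real where "s = (1 / 2) ^ n"
    have s: "s \<ge> 0" "s \<le> 1" "(1 / 2) ^ Suc n = s / 2"
      by (simp_all add: s_def power_le_one)
    have near: "near_rat s (z k)" if "k \<in> I" for k
      using Suc.IH that unfolding s_def by blast
    have near_w: "near_rat (s / 2) (w k)" if "k \<in> I" for k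
      unfolding w_def using E[OF that] near near_rat_mult_Rats[of s "z n" "E k n" "1 / 2" for n] s
      by (intro near_rat_sum) force+
    show ?case
      unfolding s(3)
    proof
      fix k assume k: "k \<in> I"
      \<comment> \<open>Row k with the eigenvalue eliminated. The cases below divide by whichever of
        \<open>d m\<close> and \<open>d k\<close> has the larger absolute value, that is, the
        smaller index.\<close>
      have eqk: "d m * (1 + w m) * z k = d k * (z k + w k)"
        using eq[OF k] unfolding l w_def .
      consider "k = m" | "m < k" | "k < m" by linarith
      then show "near_rat (s / 2) (z k)"
      proof cases
        case 1
        then show ?thesis using m s by (simp add: near_rat_Rats)
      next
        case 2
        define r where "r = d k / d m"
        have r: "r \<in> \<rat>" "absval r \<le> 1 / 4"
          using d(1,3) 2 by (auto simp: r_def)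
        have "(1 + w m) * z k = r * (z k + w k)"
          using eqk d(2)[of m] by (simp add: r_def field_simps)
        \<comment> \<open>The quadratic term \<open>w m * z k\<close> is expanded so that each
          rational factor \<open>E m n\<close> acts on \<open>z n * z k\<close>, a product inside
          the unit ball that is again within s of the rationals.\<close>
        then have zk: "z k = r * z k + r * w k - (\<Sum>n\<in>J m. E m n * (z n * z k))"
          by (simp add: w_def algebra_simps sum_distrib_left sum_distrib_right)
        have "near_rat (s / 2) (r * z k)"
          using near_rat_mult_Rats[OF near[OF k] r] s by (auto intro: near_rat_mono)
        moreover have "near_rat (s / 2) (r * w k)"
          using near_rat_mult_Rats[OF near_w[OF k] r] s by (auto intro: near_rat_mono)
        moreover have "near_rat (s / 2) (\<Sum>n\<in>J m. E m n * (z n * z k))"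
        proof (rule near_rat_sum)
          fix n assume n: "n \<in> J m"
          have "near_rat s (z n * z k)"
            using E[OF m(1) n] near z k s by (intro near_rat_mult) auto
          then show "near_rat (s / 2) (E m n * (z n * z k))"
            using near_rat_mult_Rats[of s "z n * z k" "E m n" "1 / 2"] E[OF m(1) n] by simp
        qed (use s in simp)
        ultimately show ?thesis
          by (subst zk) (intro near_rat_diff near_rat_add)
      next
        case 3
        define r where "r = d m / d k"
        have r: "r \<in> \<rat>" "absval r \<le> 1 / 4"
          using d(1,3) 3 by (auto simp: r_def)
        have zk: "z k = r * ((1 + w m) * z k) - w k"
          using eqk d(2)[of k] by (simp add: r_def field_simps)
        have "near_rat s (1 + w m)"
          using near_w[OF m(1)] s by (intro near_rat_add) (auto intro: near_rat_mono near_rat_Rats)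
        moreover have "absval (1 + w m) \<le> 1"
          using w[OF m(1)] by (intro absval_add_le) auto
        ultimately have "near_rat s ((1 + w m) * z k)"
          using near[OF k] z[OF k] s by (intro near_rat_mult)
        then have "near_rat (s / 2) (r * ((1 + w m) * z k))"
          using near_rat_mono[OF near_rat_mult_Rats[OF _ r], of s "(1 + w m) * z k" "s / 2"] s by simp
        then show ?thesis
          by (subst zk) (intro near_rat_diff near_w k)
      qed
    qed
  qed
  note approx = this
  show ?thesis
    unfolding Q2_iff
  proof safe
    fix s :: real assume "s > 0"
    then obtain n where "(1 / 2) ^ n < s"
      using real_arch_pow_inv[of s "1 / 2"] by auto
    then show "near_rat s (z k)"
      using approx[of n] \<open>k \<in> I\<close> by (meson less_imp_le near_rat_mono)
  qed
qed

section \<open>The triangular and diagonal factors: rationality and product formulas\<close>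

lemma fact_in_Rats: "fact n \<in> (\<rat> :: 'a::field_char_0 set)"
  by (metis Rats_of_nat of_nat_fact)

lemma inv_fact_in_Rats: "inv_fact n \<in> \<rat>"
  unfolding inv_fact_def by (auto intro: Rats_divide fact_in_Rats)

lemma lower_coeff_in_Rats: "lower_coeff i k \<in> \<rat>"
  unfolding lower_coeff_def
  by (intro Rats_mult Rats_divide Rats_power fact_in_Rats inv_fact_in_Rats Rats_number_of)

lemma diag_coeff_in_Rats: "diag_coeff k \<in> \<rat>"
  unfolding diag_coeff_def
  by (intro Rats_mult Rats_divide Rats_power fact_in_Rats Rats_number_of)

lemma lower_coeff_eq_0: "i < k \<or> 2 * k < i \<Longrightarrow> lower_coeff i k = 0"
  by (auto simp: lower_coeff_def)

lemma lower_coeff_self: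
  assumes "k \<ge> 1"
  shows "lower_coeff k k = 1"
proof -
  have e: "2 * k + k - 1 = 3 * k - 1" "2 * int k - int k = int k" "int k - int k = int 0" "k + k = 2 * k"
    by simp_all
  show ?thesis
    unfolding lower_coeff_def e inv_fact_of_nat by (simp add: power2_eq_square)
qed

lemma lower_coeff_rec:
  assumes "k \<ge> 1"
  shows "of_nat (2 * i + 1) * of_int (int i + 1 - int k) * of_nat (i + k + 1) * lower_coeff (i + 1) k =
    2 * of_nat (i + 1) * of_nat (2 * k + i) * of_int (2 * int k - int i) * (lower_coeff i k :: 'a::field_char_0)"
proof -
  define x y :: 'a where "x = of_nat i" and "y = of_nat k"
  define X Y :: 'a where "X = inv_fact (2 * int k - int i)" and "Y = inv_fact (int i + 1 - int k)"
  have X1: "inv_fact (2 * int k - int (i + 1)) = (2 * y - x) * X"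
    unfolding X_def by (subst inv_fact_pred[of _ "2 * int k - int i"]) (simp_all add: x_def y_def)
  have Y1: "inv_fact (int i - int k) = (x + 1 - y) * Y"
    unfolding Y_def by (subst inv_fact_pred[of _ "int i + 1 - int k"]) (simp_all add: x_def y_def)
  have Y2: "inv_fact (int (i + 1) - int k) = Y"
    by (simp add: Y_def add_ac)
  define p q r s a :: 'a where "p = fact (2 * i)" and "q = fact (i + k)" and "r = fact i"
    and "s = fact (2 * k + i - 1)" and "a = fact (2 * k) ^ 2 / (4 ^ k * fact k * fact (3 * k - 1))"
  define u v w where "u = x + 1" and "v = 2 * x + 1" and "w = x + y + 1"
  have nz: "u \<noteq> 0" "v \<noteq> 0" "w \<noteq> 0" "p \<noteq> 0" "q \<noteq> 0" "r \<noteq> 0"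
  proof -
    have "u = of_nat (Suc i)" "v = of_nat (Suc (2 * i))" "w = of_nat (Suc (i + k))"
      by (simp_all add: u_def v_def w_def x_def y_def)
    then show "u \<noteq> 0" "v \<noteq> 0" "w \<noteq> 0"
      by (simp_all only: of_nat_neq_0 not_False_eq_True)
  qed (simp_all add: p_def q_def r_def)
  have facts: "fact (2 * (i + 1)) = 2 * u * v * p" "fact (i + 1 + k) = w * q" "fact (i + 1) = u * r"
    "fact (2 * k + (i + 1) - 1) = (2 * y + x) * s"
  proof -
    have "2 * (i + 1) = Suc (Suc (2 * i))" by simp
    then show "fact (2 * (i + 1)) = 2 * u * v * p"
      by (simp add: u_def v_def x_def p_def algebra_simps)
    have "fact (2 * k + i) = (of_nat (2 * k + i) * fact (2 * k + i - 1) :: 'a)"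
      using assms by (intro fact_reduce) simp
    then show "fact (2 * k + (i + 1) - 1) = (2 * y + x) * s"
      by (simp add: x_def y_def s_def)
  qed (simp_all add: u_def w_def x_def y_def q_def r_def add_ac)
  have L: "lower_coeff (i + 1) k = 4 * 4 ^ i * (u * r)\<^sup>2 * a * ((2 * y + x) * s) / (2 * u * v * p * (w * q)) * ((2 * y - x) * X) * Y"
    unfolding lower_coeff_def X1 Y2 facts a_def by simp
  have L': "lower_coeff i k = 4 ^ i * r\<^sup>2 * a * s / (p * q) * X * ((x + 1 - y) * Y)"
    unfolding lower_coeff_def X_def[symmetric] Y1 a_def p_def q_def r_def s_def by simp
  have coeffs: "of_nat (2 * i + 1) = v" "of_int (int i + 1 - int k) = x + 1 - y" "of_nat (i + k + 1) = w"
    "of_nat (i + 1) = u" "of_nat (2 * k + i) = 2 * y + x" "of_int (2 * int k - int i) = 2 * y - x"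
    by (simp_all add: x_def y_def u_def v_def w_def)
  show ?thesis
    unfolding coeffs L L' using nz by (simp add: divide_simps) (simp add: power2_eq_square)
qed

text \<open>The recurrence is unrolled down column k from its diagonal entry 1. The ratios (k -
  d)/(d + 1) assemble into the binomial coefficient, which is kept because the bound for B needs
  it.\<close>

lemma lower_coeff_closed:
  assumes "k \<ge> 1"
  shows "lower_coeff (k + d) k * (\<Prod>m<d. of_nat (2 * (k + m) + 1)) * (\<Prod>m<d. of_nat (2 * k + m + 1)) =
    2 ^ d * of_nat (k choose d) * (\<Prod>m<d. of_nat (k + m + 1)) * (\<Prod>m<d. of_nat (3 * k + m) :: 'a::field_char_0)"
proof (induction d)
  case 0
  then show ?case using lower_coeff_self[OF assms] by simp
next
  case (Suc d)
  define A B C D :: 'a where "A = (\<Prod>m<d. of_nat (2 * (k + m) + 1))" and "B = (\<Prod>m<d. of_nat (2 * k + m + 1))"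
    and "C = (\<Prod>m<d. of_nat (k + m + 1))" and "D = (\<Prod>m<d. of_nat (3 * k + m))"
  define L M :: 'a where "L = lower_coeff (k + d) k" and "M = lower_coeff (k + Suc d) k"
  define a b c e t u where "a = (of_nat (2 * (k + d) + 1) :: 'a)" and "b = (of_nat (2 * k + d + 1) :: 'a)"
    and "c = (of_nat (k + d + 1) :: 'a)" and "e = (of_nat (3 * k + d) :: 'a)"
    and "t = (of_nat (d + 1) :: 'a)" and "u = (of_int (int k - int d) :: 'a)"
  have rec: "a * t * b * M = 2 * c * e * u * L"
    using lower_coeff_rec[OF assms, of "k + d", where ?'a='a]
    by (simp add: a_def b_def c_def e_def t_def u_def L_def M_def algebra_simps)
  have choose: "t * of_nat (k choose Suc d) = u * of_nat (k choose d)"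
  proof (cases "d \<le> k")
    case True
    have "(d + 1) * (k choose Suc d) = (k - d) * (k choose d)"
      using binomial_absorption[of d k] binomial_absorb_comp[of k d] by simp
    then have "of_nat ((d + 1) * (k choose Suc d)) = (of_nat ((k - d) * (k choose d)) :: 'a)"
      by (simp only:)
    then show ?thesis
      using True by (simp add: t_def u_def of_nat_diff algebra_simps)
  next
    case False
    then show ?thesis by (simp add: binomial_eq_0)
  qed
  have "t \<noteq> 0"
    unfolding t_def using of_nat_neq_0[of d, where ?'a='a] by simp
  have IH: "L * A * B = 2 ^ d * of_nat (k choose d) * C * D"
    using Suc by (simp add: A_def B_def C_def D_def L_def)
  have "t * (M * (A * a) * (B * b)) = (a * t * b * M) * A * B"
    by (simp add: mult_ac)
  also have "\<dots> = 2 * c * e * u * (L * A * B)"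
    unfolding rec by (simp add: mult_ac)
  also have "\<dots> = t * (2 ^ Suc d * of_nat (k choose Suc d) * (C * c) * (D * e))"
    unfolding IH using arg_cong[OF choose, of "\<lambda>x. x * (2 * c * e * 2 ^ d * C * D)"]
    by (simp only: power_Suc mult_ac)
  finally show ?case
    using \<open>t \<noteq> 0\<close> by (simp add: A_def B_def C_def D_def M_def a_def b_def c_def e_def)
qed

text \<open>For the size of consecutive ratios: 2k + 1 and 9 are odd while (3k+1)(3k+2) is even, so
  each step gains a factor of at least 4.\<close>

lemma diag_coeff_rec:
  "diag_coeff (Suc k) * of_nat (2 * k + 1) ^ 4 =
    diag_coeff k * 9 * (of_nat ((3 * k + 1) * (3 * k + 2)) :: 'a::field_char_0) ^ 2"
proof -
  define x :: 'a where "x = of_nat k"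
  define p q r where "p = (fact (3 * k) :: 'a)" and "q = (fact k :: 'a)" and "r = (fact (2 * k) :: 'a)"
  define u v where "u = x + 1" and "v = 2 * x + 1"
  have nz: "u \<noteq> 0" "v \<noteq> 0" "r \<noteq> 0"
  proof -
    have "u = of_nat (Suc k)" "v = of_nat (Suc (2 * k))"
      by (simp_all add: u_def v_def x_def)
    then show "u \<noteq> 0" "v \<noteq> 0"
      by (simp_all only: of_nat_neq_0 not_False_eq_True)
  qed (simp add: r_def)
  have facts: "fact (3 * Suc k) = 3 * u * (3 * x + 2) * (3 * x + 1) * p" "fact (Suc k) = u * q"
    "fact (2 * Suc k) = 2 * u * v * r"
  proof -
    have e: "3 * Suc k = Suc (Suc (Suc (3 * k)))" "2 * Suc k = Suc (Suc (2 * k))" by simp_all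
    show "fact (3 * Suc k) = 3 * u * (3 * x + 2) * (3 * x + 1) * p"
      "fact (2 * Suc k) = 2 * u * v * r"
      unfolding e fact_Suc by (simp_all add: u_def v_def x_def p_def r_def algebra_simps)
  qed (simp add: u_def x_def q_def)
  have d: "diag_coeff (Suc k) = 16 * 2 ^ (4 * k + 1) * (3 * u * (3 * x + 2) * (3 * x + 1) * p)\<^sup>2 * (u * q)\<^sup>2 / (3 * (2 * u * v * r) ^ 4)"
    unfolding diag_coeff_def facts by (simp add: power_add)
  have d': "diag_coeff k = 2 ^ (4 * k + 1) * p\<^sup>2 * q\<^sup>2 / (3 * r ^ 4)"
    unfolding diag_coeff_def p_def q_def r_def ..
  have coeffs: "of_nat (2 * k + 1) = v" "of_nat ((3 * k + 1) * (3 * k + 2)) = (3 * x + 1) * (3 * x + 2)"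
    by (simp_all add: v_def x_def algebra_simps)
  show ?thesis
    unfolding d d' coeffs using nz by (simp add: divide_simps power_mult_distrib)
qed

lemma diag_coeff_nz: "diag_coeff k \<noteq> (0 :: 'a::field_char_0)"
  by (simp add: diag_coeff_def)

section \<open>2-adic bounds for A, B and D\<close>

context
  fixes dummy :: "'a::nonarch_valued_field itself"
  assumes absval_of_int: "\<And>n. n \<noteq> 0 \<Longrightarrow> absval (of_int n :: 'a) = (1 / 2) ^ multiplicity 2 n"
begin

lemma absval_of_nat: "n > 0 \<Longrightarrow> absval (of_nat n :: 'a) = (1 / 2) ^ multiplicity 2 (int n)"
  using absval_of_int[of "int n"] by simp

lemma absval_of_nat_le_1: "absval (of_nat n :: 'a) \<le> 1"
  by (cases "n = 0") (simp_all add: absval_of_nat power_le_one)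

lemma absval_odd: "odd n \<Longrightarrow> absval (of_nat n :: 'a) = 1"
  by (cases "n = 0") (simp_all add: absval_of_nat not_dvd_imp_multiplicity_0)

lemma absval_2: "absval (2 :: 'a) = 1 / 2"
  using absval_of_nat[of 2] by simp

lemma absval_even_le:
  assumes "even n"
  shows "absval (of_nat n :: 'a) \<le> 1 / 2"
proof -
  obtain m where "n = 2 * m" using assms by (rule evenE)
  then show ?thesis
    using absval_mult_le[of "2 :: 'a" "1 / 2" "of_nat m" 1] absval_of_nat_le_1[of m] by (simp add: absval_2)
qed

text \<open>The even numbers among 2k+1, ..., 2k+d are the doubles of k+1, ..., k + d div 2.\<close>

lemma absval_prod_progression:
  "absval (\<Prod>m<d. of_nat (2 * k + m + 1) :: 'a) =
    (1 / 2) ^ (d div 2) * absval (\<Prod>m<d div 2. of_nat (k + m + 1) :: 'a)"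
proof (induction d)
  case (Suc d)
  show ?case
  proof (cases "even d")
    case True
    then have "odd (2 * k + d + 1)" "Suc d div 2 = d div 2" by simp_all
    then show ?thesis
      using Suc absval_odd[of "2 * k + d + 1"] by (simp only: prod.lessThan_Suc absval_mult) simp
  next
    case False
    then obtain e where e: "d = 2 * e + 1" by (rule oddE)
    have "Suc d div 2 = Suc e" "d div 2 = e" "2 * k + d + 1 = 2 * (k + e + 1)"
      using e by simp_all
    then show ?thesis
      using Suc by (simp only: prod.lessThan_Suc absval_mult of_nat_mult of_nat_numeral absval_2) simp
  qed
qed simp

lemma absval_prod_consecutive_le:
  "absval (\<Prod>m<d. of_nat (a + m) :: 'a) \<le> (1 / 2) ^ (d div 2)"
proof (induction d rule: induct_nat_012)
  case 1
  show ?case using absval_of_nat_le_1[of a] by simp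
next
  case (ge2 d)
  have "absval (of_nat ((a + d) * (a + Suc d)) :: 'a) \<le> 1 / 2"
    by (rule absval_even_le) simp
  then have "absval ((\<Prod>m<d. of_nat (a + m)) * of_nat ((a + d) * (a + Suc d)) :: 'a) \<le> (1 / 2) ^ (d div 2) * (1 / 2)"
    using ge2 by (intro absval_mult_le)
  then show ?case
    by (simp only: prod.lessThan_Suc of_nat_mult mult.assoc) (simp add: mult.assoc)
qed simp

lemma absval_prod_antimono:
  fixes d e :: nat
  assumes "e \<le> d"
  shows "absval (\<Prod>m<d. of_nat (f m) :: 'a) \<le> absval (\<Prod>m<e. of_nat (f m) :: 'a)"
  using assms
proof (induction d rule: dec_induct)
  case (step d)
  then show ?case
    using absval_mult_le[of "\<Prod>m<d. of_nat (f m) :: 'a" _ "of_nat (f d)" 1] absval_of_nat_le_1 by simp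
qed simp

text \<open>In the closed form the only even denominators lie in (2k+1)...(2k+d). Of their 2-part,
  the numerator (k+1)...(k+d) absorbs (k+1)...(k + d div 2), and the d consecutive numbers from 3k
  on absorb the powers of 2. This leaves 2^d and the binomial coefficient.\<close>

lemma absval_lower_coeff:
  assumes "k \<ge> 1"
  shows "absval (lower_coeff (k + d) k :: 'a) \<le> (1 / 2) ^ d * absval (of_nat (k choose d) :: 'a)"
proof -
  define L c where "L = absval (lower_coeff (k + d) k :: 'a)" and "c = absval (of_nat (k choose d) :: 'a)"
  define p where "p = absval (\<Prod>m<d. of_nat (2 * k + m + 1) :: 'a)"
  have odd: "absval (\<Prod>m<d. of_nat (2 * (k + m) + 1) :: 'a) = 1"
    unfolding absval_prod by (intro prod.neutral ballI absval_odd) simp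
  have "(\<Prod>m<d. of_nat (2 * k + m + 1) :: 'a) \<noteq> 0"
    by (simp del: of_nat_add of_nat_mult of_nat_Suc)
  then have p: "p > 0"
    unfolding p_def using absval_nonneg absval_eq_0_iff by (metis less_eq_real_def)
  have "absval ((\<Prod>m<d. of_nat (k + m + 1)) * (\<Prod>m<d. of_nat (3 * k + m)) :: 'a) \<le>
      absval (\<Prod>m<d div 2. of_nat (k + m + 1) :: 'a) * (1 / 2) ^ (d div 2)"
    by (intro absval_mult_le absval_prod_antimono absval_prod_consecutive_le) simp
  also have "\<dots> = p"
    unfolding p_def absval_prod_progression by simp
  finally have *: "absval ((\<Prod>m<d. of_nat (k + m + 1)) * (\<Prod>m<d. of_nat (3 * k + m)) :: 'a) \<le> p" .
  have "L * p = (1 / 2) ^ d * c * absval ((\<Prod>m<d. of_nat (k + m + 1)) * (\<Prod>m<d. of_nat (3 * k + m)) :: 'a)"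
    using arg_cong[OF lower_coeff_closed[OF assms, of d, where ?'a='a], of absval] odd
    unfolding absval_mult absval_power absval_2 L_def c_def p_def by (simp only: mult_1_right mult.assoc)
  also have "\<dots> \<le> (1 / 2) ^ d * c * p"
    using * by (intro mult_left_mono) (simp_all add: c_def)
  finally show ?thesis
    using p unfolding L_def c_def by simp
qed

lemma absval_lower_coeff_le_half:
  assumes "k \<ge> 1" "i \<noteq> k"
  shows "absval (lower_coeff i k :: 'a) \<le> 1 / 2"
proof (cases "i < k")
  case True
  then show ?thesis by (simp add: lower_coeff_eq_0)
next
  case False
  define d where "d = i - k"
  have i: "i = k + d" "d \<ge> 1" using False assms by (simp_all add: d_def)
  have "absval (lower_coeff i k :: 'a) \<le> (1 / 2) ^ d * absval (of_nat (k choose d) :: 'a)"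
    unfolding i by (rule absval_lower_coeff[OF assms(1)])
  also have "\<dots> \<le> (1 / 2) ^ 1 * 1"
    using i absval_of_nat_le_1 by (intro mult_mono power_decreasing) auto
  finally show ?thesis by simp
qed

lemma absval_lower_coeff_le_1: "k \<ge> 1 \<Longrightarrow> absval (lower_coeff i k :: 'a) \<le> 1"
  using absval_lower_coeff_le_half[of k i] by (cases "i = k") (auto simp: lower_coeff_self)

text \<open>The danger is the division by k. Absorption, C(k,d)/k = C(k-1,d-1)/d, trades it for a
  division by d, and v(d) \<le> d - 1 leaves one 2 of the factor 2^d.\<close>

lemma absval_upper_coeff_le_half:
  assumes "k \<ge> 1" "j \<noteq> k"
  shows "absval (lower_coeff j k * of_nat j / of_nat k :: 'a) \<le> 1 / 2"
proof (cases "j < k")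
  case True
  then show ?thesis by (simp add: lower_coeff_eq_0)
next
  case False
  define d where "d = j - k"
  have j: "j = k + d" "d \<ge> 1" using False assms by (simp_all add: d_def)
  have "k * ((k - 1) choose (d - 1)) = d * (k choose d)"
    using binomial_absorption[of "d - 1" k] j by simp
  then have "of_nat (k * ((k - 1) choose (d - 1))) = (of_nat (d * (k choose d)) :: 'a)"
    by (simp only:)
  then have ch: "of_nat (k choose d) / of_nat k = (of_nat ((k - 1) choose (d - 1)) / of_nat d :: 'a)"
    using assms j by (simp add: field_simps)
  have "2 ^ multiplicity 2 (int d) \<le> int d"
    using j by (intro zdvd_imp_le multiplicity_dvd) auto
  then have "int (2 ^ multiplicity 2 (int d)) \<le> int d"
    by (simp only: of_nat_power of_nat_numeral)
  then have "2 ^ multiplicity 2 (int d) \<le> d"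
    by (simp only: of_nat_le_iff)
  then have "multiplicity 2 (int d) < d"
    using less_exp[of "multiplicity 2 (int d)"] by linarith
  then have "(1 / 2) ^ (d - 1) \<le> (1 / 2 :: real) ^ multiplicity 2 (int d)"
    by (intro power_decreasing) auto
  then have ad: "(1 / 2) ^ (d - 1) \<le> absval (of_nat d :: 'a)"
    using absval_of_nat[of d] j by simp
  have "absval (lower_coeff j k * of_nat j / of_nat k :: 'a) =
      absval (lower_coeff j k :: 'a) * absval (of_nat j :: 'a) / absval (of_nat k :: 'a)"
    by (simp add: absval_mult absval_divide)
  also have "\<dots> \<le> ((1 / 2) ^ d * absval (of_nat (k choose d) :: 'a)) * 1 / absval (of_nat k :: 'a)"
    using absval_lower_coeff[OF assms(1), of d] absval_of_nat_le_1[of j] unfolding j(1)[symmetric]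
    by (intro divide_right_mono mult_mono) auto
  also have "\<dots> = (1 / 2) ^ d * absval (of_nat (k choose d) / of_nat k :: 'a)"
    by (simp add: absval_divide)
  also have "\<dots> = (1 / 2) ^ d * absval (of_nat ((k - 1) choose (d - 1)) :: 'a) / absval (of_nat d :: 'a)"
    unfolding ch by (simp add: absval_divide)
  also have "\<dots> \<le> (1 / 2) ^ d * 1 / (1 / 2) ^ (d - 1)"
    using ad absval_of_nat_le_1 by (intro frac_le mult_left_mono) auto
  also have "\<dots> = 1 / 2"
    using j by (cases d) simp_all
  finally show ?thesis .
qed

lemma absval_upper_coeff_le_1: "k \<ge> 1 \<Longrightarrow> absval (lower_coeff j k * of_nat j / of_nat k :: 'a) \<le> 1"
  using absval_upper_coeff_le_half[of k j] by (cases "j = k") (auto simp: lower_coeff_self)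

lemma absval_diag_coeff_Suc: "absval (diag_coeff (Suc k) :: 'a) \<le> absval (diag_coeff k :: 'a) / 4"
proof -
  have 1: "absval (of_nat (2 * k + 1) :: 'a) = 1" "absval (9 :: 'a) = 1"
    using absval_odd[of 9] by (simp_all add: absval_odd del: of_nat_Suc of_nat_add)
  have 2: "absval (of_nat ((3 * k + 1) * (3 * k + 2)) :: 'a) \<le> 1 / 2"
    by (rule absval_even_le) simp
  have "absval (diag_coeff (Suc k) :: 'a) = absval (diag_coeff k :: 'a) * absval (of_nat ((3 * k + 1) * (3 * k + 2)) :: 'a) ^ 2"
    using arg_cong[OF diag_coeff_rec[of k, where ?'a='a], of absval]
    unfolding absval_mult absval_power 1 by simp
  also have "\<dots> \<le> absval (diag_coeff k :: 'a) * (1 / 2) ^ 2"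
    using 2 by (intro mult_left_mono power_mono) auto
  finally show ?thesis by (simp add: power2_eq_square)
qed

lemma absval_diag_coeff_less:
  assumes "k < n"
  shows "absval (diag_coeff n :: 'a) \<le> absval (diag_coeff k :: 'a) / 4"
  using assms
proof (induction n)
  case (Suc n)
  show ?case
  proof (cases "k = n")
    case True
    then show ?thesis using absval_diag_coeff_Suc[of n] by simp
  next
    case False
    then have "absval (diag_coeff n :: 'a) \<le> absval (diag_coeff k :: 'a) / 4"
      using Suc by simp
    then show ?thesis
      using absval_diag_coeff_Suc[of n] absval_nonneg[of "diag_coeff n :: 'a"] by linarith
  qed
qed simp

lemma absval_diag_coeff_le_1: "k \<ge> 1 \<Longrightarrow> absval (diag_coeff k :: 'a) \<le> 1"
proof -
  assume "k \<ge> 1"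
  moreover have "absval (diag_coeff 0 :: 'a) = 1 / 2"
    using absval_odd[of 3] by (simp add: diag_coeff_def absval_divide absval_2)
  ultimately show ?thesis
    using absval_diag_coeff_less[of 0 k] by simp
qed

text \<open>With \<open>U = A D B\<close> and \<open>c a = U a\<close>, the vector \<open>z = D B a\<close> satisfies \<open>c z = D (B A) z\<close>, and \<open>B A\<close> is
  congruent to the identity modulo 2.\<close>

lemma eigenvector_multiple_in_Q2:
  fixes a :: "nat \<Rightarrow> 'a"
  assumes a: "a \<longlonglongrightarrow> 0" and c: "c \<noteq> 0"
    and eq: "\<And>i. i \<ge> 1 \<Longrightarrow> c * a i = (\<Sum>j=1..2*i. u_coeff i j * a j)"
    and nz: "i0 \<ge> 1" "a i0 \<noteq> 0"
  shows "\<exists>r. r \<noteq> 0 \<and> (\<forall>i\<ge>1. r * a i \<in> Q2)"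
proof -
  define B :: "nat \<Rightarrow> nat \<Rightarrow> 'a" where "B k j = lower_coeff j k * of_nat j / of_nat k" for k j
  define y where "y k = (\<Sum>j=1..2*k. B k j * a j)" for k
  define z where "z k = diag_coeff k * y k" for k
  have B0: "B k j = 0" if "j < k \<or> 2 * k < j" for k j
    using that by (simp add: B_def lower_coeff_eq_0)
  \<comment> \<open>This is c a = A z: since c is nonzero, z cannot vanish, and rationality passes
    back from multiples of z to multiples of a.\<close>
  have eqA: "c * a i = (\<Sum>k=1..i. lower_coeff i k * z k)" if i: "i \<ge> 1" for i
  proof -
    have "c * a i = (\<Sum>j=1..2*i. (\<Sum>k=1..j. lower_coeff i k * (diag_coeff k * B k j)) * a j)"
      unfolding eq[OF i] B_def using i by (intro sum.cong refl) (simp add: u_coeff_factorization)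
    also have "\<dots> = (\<Sum>j=1..2*i. (\<Sum>k=1..2*i. lower_coeff i k * (diag_coeff k * B k j)) * a j)"
      by (intro sum.cong refl arg_cong2[where f="(*)"] sum.mono_neutral_left) (auto simp: B0)
    also have "\<dots> = (\<Sum>j=1..2*i. \<Sum>k=1..2*i. lower_coeff i k * (diag_coeff k * (B k j * a j)))"
      by (simp add: sum_distrib_right mult.assoc)
    also have "\<dots> = (\<Sum>k=1..2*i. \<Sum>j=1..2*i. lower_coeff i k * (diag_coeff k * (B k j * a j)))"
      by (rule sum.swap)
    also have "\<dots> = (\<Sum>k=1..2*i. lower_coeff i k * (diag_coeff k * (\<Sum>j=1..2*i. B k j * a j)))"
      by (simp add: sum_distrib_left)
    also have "\<dots> = (\<Sum>k=1..i. lower_coeff i k * (diag_coeff k * (\<Sum>j=1..2*i. B k j * a j)))"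
      by (intro sum.mono_neutral_right) (auto simp: lower_coeff_eq_0)
    also have "\<dots> = (\<Sum>k=1..i. lower_coeff i k * z k)"
      unfolding z_def y_def
      by (intro sum.cong refl arg_cong2[where f="(*)"] sum.mono_neutral_right) (auto simp: B0)
    finally show ?thesis .
  qed
  define C where "C k l = (\<Sum>j=1..2*k. B k j * lower_coeff j l)" for k l
  define E where "E k l = C k l - (if l = k then 1 else 0)" for k l
  have eqZ: "c * z k = diag_coeff k * (z k + (\<Sum>l=1..2*k. E k l * z l))" if k: "k \<ge> 1" for k
  proof -
    have "c * y k = (\<Sum>j=1..2*k. B k j * (c * a j))"
      by (simp add: y_def sum_distrib_left mult_ac)
    also have "\<dots> = (\<Sum>j=1..2*k. B k j * (\<Sum>l=1..j. lower_coeff j l * z l))"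
      by (intro sum.cong refl) (simp add: eqA)
    also have "\<dots> = (\<Sum>j=1..2*k. B k j * (\<Sum>l=1..2*k. lower_coeff j l * z l))"
      by (intro sum.cong refl arg_cong2[where f="(*)"] sum.mono_neutral_left) (auto simp: lower_coeff_eq_0)
    also have "\<dots> = (\<Sum>j=1..2*k. \<Sum>l=1..2*k. B k j * lower_coeff j l * z l)"
      by (simp add: sum_distrib_left mult.assoc)
    also have "\<dots> = (\<Sum>l=1..2*k. \<Sum>j=1..2*k. B k j * lower_coeff j l * z l)"
      by (rule sum.swap)
    also have "\<dots> = (\<Sum>l=1..2*k. C k l * z l)"
      by (simp add: C_def sum_distrib_right)
    also have "\<dots> = (\<Sum>l=1..2*k. E k l * z l + (if l = k then z l else 0))"
      by (intro sum.cong refl) (simp add: E_def algebra_simps)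
    also have "\<dots> = z k + (\<Sum>l=1..2*k. E k l * z l)"
      using k by (simp add: sum.distrib)
    finally show ?thesis
      by (simp add: z_def mult_ac)
  qed
  have E: "E k l \<in> \<rat> \<and> absval (E k l) \<le> 1 / 2" if k: "k \<ge> 1" and l: "l \<ge> 1" for k l
  proof
    have "B k j \<in> \<rat>" for j
      unfolding B_def by (intro Rats_mult Rats_divide lower_coeff_in_Rats Rats_of_nat)
    then show "E k l \<in> \<rat>"
      unfolding E_def C_def by (auto intro!: Rats_diff Rats_sum Rats_mult lower_coeff_in_Rats)
    have "B k k = 1"
      using k by (simp add: B_def lower_coeff_self)
    \<comment> \<open>Splitting off j = k, where B has entry 1, leaves A - 1 plus products
      containing an off-diagonal entry of B.\<close>
    then have "E k l = (lower_coeff k l - (if l = k then 1 else 0)) + (\<Sum>j\<in>{1..2*k}-{k}. B k j * lower_coeff j l)"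
      unfolding E_def C_def using k by (subst sum.remove[of _ k]) auto
    also have "absval \<dots> \<le> 1 / 2"
    proof (intro absval_add_le absval_sum_le)
      show "absval (lower_coeff k l - (if l = k then 1 else 0) :: 'a) \<le> 1 / 2"
        using l absval_lower_coeff_le_half[of l k] by (auto simp: lower_coeff_self)
      fix j assume "j \<in> {1..2*k} - {k}"
      then show "absval (B k j * lower_coeff j l) \<le> 1 / 2"
        using absval_mult_le[of "B k j" "1 / 2" "lower_coeff j l" 1] k l
          absval_upper_coeff_le_half[of k j] absval_lower_coeff_le_1[of l j]
        by (simp add: B_def)
    qed simp
    finally show "absval (E k l) \<le> 1 / 2" .
  qed
  have "\<exists>k\<ge>1. z k \<noteq> 0"
  proof (rule ccontr)
    assume "\<not> (\<exists>k\<ge>1. z k \<noteq> 0)"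
    then have "c * a i0 = 0"
      unfolding eqA[OF nz(1)] by (intro sum.neutral) auto
    then show False using c nz by simp
  qed
  then obtain k0 where k0: "k0 \<ge> 1" "z k0 \<noteq> 0" by auto
  \<comment> \<open>The largest |z_k| over infinitely many k must be attained. Row k of B starts at
    j = k, and B and D have entries of absolute value at most 1, so z tends to 0 with a; only
    finitely many k reach the threshold |z_k0|.\<close>
  define e where "e = absval (z k0)"
  have e: "e > 0"
    using k0 absval_nonneg[of "z k0"] absval_eq_0_iff[of "z k0"] unfolding e_def by linarith
  have "\<exists>N. \<forall>n\<ge>N. dist (a n) 0 < e / 2"
    using a e unfolding lim_sequentially by (meson half_gt_zero)
  then obtain N where "\<forall>n\<ge>N. dist (a n) 0 < e / 2" ..
  then have N: "absval (a n) \<le> e / 2" if "n \<ge> N" for n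
    using that by (metis diff_zero dist_absval less_imp_le)
  have small: "absval (z k) < e" if k: "k \<ge> 1" "k \<ge> N" for k
  proof -
    have "absval (B k j * a j) \<le> e / 2" for j
    proof (cases "j < k")
      case True
      then show ?thesis using e by (simp add: B0)
    next
      case False
      then show ?thesis
        using k absval_mult_le[of "B k j" 1 "a j" "e / 2"] absval_upper_coeff_le_1[of k j] N[of j]
        by (simp add: B_def)
    qed
    then have "absval (y k) \<le> e / 2"
      unfolding y_def using e by (intro absval_sum_le) simp_all
    then have "absval (z k) \<le> 1 * (e / 2)"
      unfolding z_def using k by (intro absval_mult_le absval_diag_coeff_le_1)
    then show ?thesis using e by simp
  qed
  define S where "S = {k. k \<ge> 1 \<and> absval (z k) \<ge> e}"
  have "S \<subseteq> {..<N}"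
    unfolding S_def using small by (auto simp: not_less) (meson not_le_imp_less not_less)
  then have "finite S" by (rule finite_subset) simp
  moreover have "k0 \<in> S" using k0 by (simp add: S_def e_def)
  ultimately have "Max ((\<lambda>k. absval (z k)) ` S) \<in> (\<lambda>k. absval (z k)) ` S"
    by (intro Max_in) auto
  then obtain m where m: "m \<in> S" "Max ((\<lambda>k. absval (z k)) ` S) = absval (z m)" by auto
  have max_S: "absval (z k) \<le> absval (z m)" if "k \<in> S" for k
    unfolding m(2)[symmetric] using \<open>finite S\<close> that by (intro Max_ge) auto
  have m1: "m \<ge> 1" and zm: "absval (z m) \<ge> e"
    using m(1) by (auto simp: S_def)
  have zm0: "z m \<noteq> 0" using zm e by auto
  have max: "absval (z k) \<le> absval (z m)" if "k \<ge> 1" for k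
    using that max_S[of k] zm unfolding S_def by force
  have "z k / z m \<in> Q2" if k: "k \<ge> 1" for k
  proof (rule eigenvector_coords_in_Q2[where z="\<lambda>k. z k / z m" and d=diag_coeff and E=E and I="{1..}" and J="\<lambda>k. {1..2*k}" and l=c and m=m])
    fix k n :: nat assume "k < n"
    have "absval (diag_coeff k :: 'a) > 0"
      using diag_coeff_nz absval_nonneg absval_eq_0_iff by (metis less_eq_real_def)
    then show "absval (diag_coeff n / diag_coeff k :: 'a) \<le> 1 / 4"
      using absval_diag_coeff_less[OF \<open>k < n\<close>] by (simp add: absval_divide field_simps)
  next
    fix k :: nat assume "k \<in> {1..}"
    then have "c * z k = diag_coeff k * (z k + (\<Sum>l=1..2*k. E k l * z l))"
      using eqZ by simp
    then have "c * (z k / z m) = diag_coeff k * ((z k + (\<Sum>l=1..2*k. E k l * z l)) / z m)"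
      by (simp only: times_divide_eq_right)
    then show "c * (z k / z m) = diag_coeff k * (z k / z m + (\<Sum>l=1..2*k. E k l * (z l / z m)))"
      by (simp only: add_divide_distrib sum_divide_distrib times_divide_eq_right)
    show "absval (z k / z m) \<le> 1"
      using max[of k] \<open>k \<in> {1..}\<close> zm e by (simp add: absval_divide)
  qed (use E m1 zm0 k in \<open>auto simp: diag_coeff_in_Rats diag_coeff_nz\<close>)
  then have "c / z m * a i \<in> Q2" if "i \<ge> 1" for i
  proof -
    have "c / z m * a i = (\<Sum>k=1..i. lower_coeff i k * (z k / z m))"
      using eqA[OF that] by (simp flip: sum_divide_distrib)
    also have "\<dots> \<in> Q2"
      using \<open>\<And>k. k \<ge> 1 \<Longrightarrow> z k / z m \<in> Q2\<close>
      by (intro Q2_sum Q2_mult Q2_Rats[OF lower_coeff_in_Rats]) auto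
    finally show ?thesis .
  qed
  then show ?thesis
    using c zm0 by (intro exI[of _ "c / z m"]) auto
qed

end

section \<open>Rational q-expansion of g and the conclusion\<close>

lemma fps_mult_nth_in_Rats:
  fixes F G :: "'a::field_char_0 fps"
  assumes "\<And>n. fps_nth F n \<in> \<rat>" "\<And>n. fps_nth G n \<in> \<rat>"
  shows "fps_nth (F * G) n \<in> \<rat>"
  unfolding fps_mult_nth using assms by (intro Rats_sum Rats_mult)

lemma fps_power_nth_in_Rats:
  fixes F :: "'a::field_char_0 fps"
  assumes "\<And>n. fps_nth F n \<in> \<rat>"
  shows "fps_nth (F ^ m) n \<in> \<rat>"
proof (induction m arbitrary: n)
  case (Suc m)
  then show ?case using assms by (auto intro: fps_mult_nth_in_Rats)
qed (simp add: fps_one_nth)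

text \<open>The product form q P^24 of f replaces the quotient of discriminants, so that only sums
  and products of rationals occur.\<close>

lemma form_g_power_nth_in_Rats: "fps_nth (form_g ^ i :: 'a::field_char_0 fps) n \<in> \<rat>"
proof (rule fps_power_nth_in_Rats)
  have "fps_nth (\<Prod>k<m. 1 + fps_X ^ Suc k :: 'a fps) n \<in> \<rat>" for m n
  proof (induction m arbitrary: n)
    case (Suc m)
    have "fps_nth (1 + fps_X ^ Suc m :: 'a fps) n \<in> \<rat>" for n
      unfolding fps_add_nth fps_X_power_nth fps_one_nth by auto
    then show ?case
      unfolding prod.lessThan_Suc using Suc by (intro fps_mult_nth_in_Rats)
  qed (simp add: fps_one_nth)
  then have "fps_nth (euler_plus :: 'a fps) n \<in> \<rat>" for n
    unfolding euler_plus_def fps_nth_Abs_fps .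
  then show "fps_nth (form_g :: 'a fps) n \<in> \<rat>" for n
    unfolding form_g_def form_f_eq
    by (intro fps_mult_nth_in_Rats fps_power_nth_in_Rats) auto
qed

theorem corollary2:
  fixes F :: "'c::nonarch_valued_field fps"
  assumes "is_C2 TYPE('c)"
    and "F \<in> S0 UNIV"
    and "eigenform F" and "normalised F" and "finite_slope F"
  shows "\<forall>n. fps_nth F n \<in> Q2"
proof -
  have ext: "absval (of_int n :: 'c) = (1 / 2) ^ multiplicity 2 n" if "n \<noteq> 0" for n
    using assms(1) that unfolding is_C2_def by blast
  obtain a where F: "F = Abs_fps a oo form_g" and a: "a \<longlonglongrightarrow> 0" and F0: "fps_nth F 0 = 0"
    using assms(2) unfolding S0_def M0_def by auto
  have a0: "a 0 = 0" using F0 unfolding F by simp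
  obtain c where c: "c \<noteq> 0" "hecke_U F = fps_const c * F"
    using assms(5) unfolding finite_slope_def by auto
  have "Abs_fps (\<lambda>i. \<Sum>j=1..2*i. u_coeff i j * a j) oo form_g = (fps_const c * Abs_fps a) oo form_g"
    using c(2) unfolding F hecke_U_compose_form_g[of a, OF a0]
    by (simp add: fps_compose_mult_distrib form_g_nth)
  \<comment> \<open>The expansion in powers of g is unique because g has no constant term and linear
    coefficient 64.\<close>
  then have ab: "Abs_fps (\<lambda>i. \<Sum>j=1..2*i. u_coeff i j * a j) = fps_const c * Abs_fps a"
    by (subst (asm) fps_compose_inj_right) (simp_all add: form_g_nth[unfolded One_nat_def])
  have eq: "c * a i = (\<Sum>j=1..2*i. u_coeff i j * a j)" for i
    using arg_cong[OF ab, of "\<lambda>G. fps_nth G i"] by simp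
  have F1: "fps_nth F 1 = 1"
    using assms(4) unfolding normalised_def .
  have "\<exists>i\<ge>1. a i \<noteq> 0"
  proof (rule ccontr)
    assume "\<not> (\<exists>i\<ge>1. a i \<noteq> 0)"
    then have "a i = 0" for i using a0 by (cases i) auto
    then show False using F1 unfolding F by (simp add: fps_compose_nth)
  qed
  then obtain i0 where "i0 \<ge> 1" "a i0 \<noteq> 0" by auto
  then obtain r where r: "r \<noteq> 0" "\<And>i. i \<ge> 1 \<Longrightarrow> r * a i \<in> Q2"
    using eigenvector_multiple_in_Q2[OF ext a c(1) eq] by auto
  have rF: "r * fps_nth F n \<in> Q2" for n
  proof -
    have "r * fps_nth F n = (\<Sum>i=0..n. r * a i * fps_nth (form_g ^ i) n)"
      unfolding F fps_compose_nth by (simp add: sum_distrib_left mult.assoc)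
    also have "\<dots> \<in> Q2"
    proof (rule Q2_sum)
      fix i
      have "r * a i \<in> Q2"
        using r(2)[of i] a0 Q2_Rats[of 0] by (cases i) auto
      then show "r * a i * fps_nth (form_g ^ i) n \<in> Q2"
        by (rule Q2_mult) (rule Q2_Rats[OF form_g_power_nth_in_Rats])
    qed
    finally show ?thesis .
  qed
  \<comment> \<open>The scalar r is itself the coefficient of q in r F.\<close>
  have "r \<in> Q2"
    using rF[of 1] F1 by simp
  then show ?thesis
    using Q2_mult[OF Q2_inverse rF] r(1) by (metis left_inverse mult.assoc mult_1_left)
qed

end
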